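(* There exists a Weyl metric (a Finsler metric, on some manifold, with vanishing Weyl curvature) which is not a generalized $\tilde D$-metric.
   Context: Let $M$ be an $n$-dimensional smooth manifold. A Finsler metric on $M$ is a non-negative function $F$ on $TM$ that is $C^\infty$ on $TM_0=TM\setminus\{0\}$, positively homogeneous of degree one in $y$, and such that $g_{ij}=\frac12\frac{\partial^2F^2}{\partial y^i\partial y^j}$ is positive definite at every $y\neq 0$. Its spray coefficients are $G^i(x,y)=\frac14 g^{il}\left\{\frac{\partial^2F^2}{\partial x^k\partial y^l}y^k-\frac{\partial F^2}{\partial x^l}\right\}$. Notation: "$._k$" denotes $\partial/\partial y^k$; "$|_m$" denotes the horizontal covariant derivative with respect to the Berwald connection of $F$, e.g. $T^i{}_{j|m}=\frac{\partial T^i{}_j}{\partial x^m}-G^r{}_{.m}T^i{}_{j.r}+T^r{}_jG^i{}_{.r.m}-T^i{}_rG^r{}_{.j.m}$, and similarly for other tensors on $TM_0$. A subscript $0$ denotes contraction with $y$: $T_{|0}=T_{|m}y^m$. The Douglas tensor is $D_j{}^i{}_{kl}=\frac{\partial^3}{\partial y^j\partial y^k\partial y^l}\left(G^i-\frac1{n+1}\frac{\partial G^m}{\partial y^m}y^i\right)$. Put $\tilde D_j{}^i{}_{kl}=D_j{}^i{}_{kl|0}$. $F$ is a generalized $\tilde D$-metric if $\tilde D_j{}^i{}_{kl|0}+\mu_r\tilde D_j{}^r{}_{kl}y^i=0$ for the coefficients $\mu_r$ of some tensor. The Riemann curvature is $R^i{}_k=2\frac{\partial G^i}{\partial x^k}-\frac{\partial^2G^i}{\partial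 x^m\partial y^k}y^m+2G^m\frac{\partial^2G^i}{\partial y^m\partial y^k}-\frac{\partial G^i}{\partial y^m}\frac{\partial G^m}{\partial y^k}$. The Weyl curvature is $W^i{}_k=A^i{}_k-\frac1{n+1}A^m{}_{k.m}y^i$, where $A^i{}_k=R^i{}_k-R\,\delta^i{}_k$ and $R=\frac1{n-1}R^m{}_m$. $F$ is a Weyl metric if $W^i{}_k=0$ (equivalently, $F$ is of scalar flag curvature). *)

theory Defs
  imports "HOL-Analysis.Analysis"
begin

section \<open>Calculus on open subsets of Euclidean space\<close>

text \<open>
  The dimension is a natural number that is bound inside formulas, so a point of the Euclidean
  space with finite index set \<open>I\<close> is an element of \<^term>\<open>PiE I (\<lambda>_. UNIV) :: ('k \<Rightarrow> real) set\<close>,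
  which is the underlying set of \<^term>\<open>powertop_real I\<close>.
\<close>

definition pd :: "'k \<Rightarrow> (('k \<Rightarrow> real) \<Rightarrow> real) \<Rightarrow> ('k \<Rightarrow> real) \<Rightarrow> real" where
  "pd k f z = deriv (\<lambda>t. f (z(k := t))) (z k)"

primrec C_k_on :: "'k set \<Rightarrow> nat \<Rightarrow> ('k \<Rightarrow> real) set \<Rightarrow> (('k \<Rightarrow> real) \<Rightarrow> real) \<Rightarrow> bool" where
  "C_k_on I 0 U f \<longleftrightarrow> continuous_map (subtopology (powertop_real I) U) euclideanreal f"
| "C_k_on I (Suc m) U f \<longleftrightarrow>
     continuous_map (subtopology (powertop_real I) U) euclideanreal f \<and>
     (\<forall>k\<in>I. (\<forall>z\<in>U. (\<lambda>t. f (z(k := t))) differentiable (at (z k))) \<and> C_k_on I m U (pd k f))"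

definition smooth_on :: "'k set \<Rightarrow> ('k \<Rightarrow> real) set \<Rightarrow> (('k \<Rightarrow> real) \<Rightarrow> real) \<Rightarrow> bool" where
  "smooth_on I U f \<longleftrightarrow> (\<forall>m. C_k_on I m U f)"


section \<open>Smooth manifolds and their tangent bundle\<close>

text \<open>A chart is its domain together with its coordinate map.\<close>

type_synonym 'p chart = "'p set \<times> ('p \<Rightarrow> nat \<Rightarrow> real)"

definition chart_inv :: "'p chart \<Rightarrow> (nat \<Rightarrow> real) \<Rightarrow> 'p" where
  "chart_inv c = inv_into (fst c) (snd c)"

definition chart_change :: "'p chart \<Rightarrow> 'p chart \<Rightarrow> (nat \<Rightarrow> real) \<Rightarrow> nat \<Rightarrow> real" where
  "chart_change c d x = snd d (chart_inv c x)"

definition smooth_manifold :: "nat \<Rightarrow> 'p topology \<Rightarrow> 'p chart set \<Rightarrow> bool" where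
  "smooth_manifold n X A \<longleftrightarrow>
     Hausdorff_space X \<and> second_countable X \<and>
     (\<Union>c\<in>A. fst c) = topspace X \<and>
     (\<forall>c\<in>A. openin X (fst c) \<and>
        openin (powertop_real {..<n}) (snd c ` fst c) \<and>
        homeomorphic_map (subtopology X (fst c))
          (subtopology (powertop_real {..<n}) (snd c ` fst c)) (snd c)) \<and>
     (\<forall>c\<in>A. \<forall>d\<in>A. \<forall>i<n.
        smooth_on {..<n} (snd c ` (fst c \<inter> fst d)) (\<lambda>x. chart_change c d x i))"

definition charts_at :: "'p chart set \<Rightarrow> 'p \<Rightarrow> 'p chart set" where
  "charts_at A p = {c \<in> A. p \<in> fst c}"

text \<open>\<open>jacobian c d x i j\<close> is the derivative of the \<open>i\<close>-th coordinate of the chart \<open>d\<close> with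
  respect to the \<open>j\<close>-th coordinate of the chart \<open>c\<close>.\<close>

definition jacobian :: "'p chart \<Rightarrow> 'p chart \<Rightarrow> (nat \<Rightarrow> real) \<Rightarrow> nat \<Rightarrow> nat \<Rightarrow> real" where
  "jacobian c d x i j = pd j (\<lambda>x'. chart_change c d x' i) x"

text \<open>A tangent vector at \<open>p\<close> is the family of its component vectors in all charts around \<open>p\<close>.\<close>

type_synonym 'p tvec = "'p chart \<Rightarrow> nat \<Rightarrow> real"

definition tangent_space :: "nat \<Rightarrow> 'p chart set \<Rightarrow> 'p \<Rightarrow> 'p tvec set" where
  "tangent_space n A p =
     {v \<in> PiE (charts_at A p) (\<lambda>_. PiE {..<n} (\<lambda>_. UNIV)).
        \<forall>c\<in>charts_at A p. \<forall>d\<in>charts_at A p. \<forall>i<n.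
          v d i = (\<Sum>j<n. jacobian c d (snd c p) i j * v c j)}"

definition tvec_scale :: "nat \<Rightarrow> 'p chart set \<Rightarrow> 'p \<Rightarrow> real \<Rightarrow> 'p tvec \<Rightarrow> 'p tvec" where
  "tvec_scale n A p a v = (\<lambda>c\<in>charts_at A p. \<lambda>i\<in>{..<n}. a * v c i)"

text \<open>The tangent vector at \<open>p\<close> with components \<open>y\<close> in the chart \<open>c\<close>.\<close>

definition tvec_of :: "nat \<Rightarrow> 'p chart set \<Rightarrow> 'p chart \<Rightarrow> 'p \<Rightarrow> (nat \<Rightarrow> real) \<Rightarrow> 'p tvec" where
  "tvec_of n A c p y =
     (\<lambda>d\<in>charts_at A p. \<lambda>i\<in>{..<n}. \<Sum>j<n. jacobian c d (snd c p) i j * y j)"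

text \<open>
  A chart of the manifold induces coordinates \<open>(x, y)\<close> on the tangent bundle. They are indexed by a
  sum type: \<open>z (Inl i)\<close> is \<open>x\<^sup>i\<close> and \<open>z (Inr i)\<close> is \<open>y\<^sup>i\<close>.
\<close>

type_synonym tcoords = "nat + nat \<Rightarrow> real"

abbreviation tidx :: "nat \<Rightarrow> (nat + nat) set" where
  "tidx n \<equiv> {..<n} <+> {..<n}"

definition base :: "nat \<Rightarrow> tcoords \<Rightarrow> nat \<Rightarrow> real" where
  "base n z = (\<lambda>i\<in>{..<n}. z (Inl i))"

abbreviation dx :: "nat \<Rightarrow> (tcoords \<Rightarrow> real) \<Rightarrow> tcoords \<Rightarrow> real" where
  "dx i \<equiv> pd (Inl i)"

abbreviation dy :: "nat \<Rightarrow> (tcoords \<Rightarrow> real) \<Rightarrow> tcoords \<Rightarrow> real" where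
  "dy i \<equiv> pd (Inr i)"

text \<open>The coordinate domain in the slit tangent bundle \<open>TM\<^sub>0\<close>.\<close>

definition slit_dom :: "nat \<Rightarrow> 'p chart \<Rightarrow> tcoords set" where
  "slit_dom n c =
     {z \<in> PiE (tidx n) (\<lambda>_. UNIV). base n z \<in> snd c ` fst c \<and> (\<exists>i<n. z (Inr i) \<noteq> 0)}"

definition tchart_change :: "nat \<Rightarrow> 'p chart \<Rightarrow> 'p chart \<Rightarrow> tcoords \<Rightarrow> tcoords" where
  "tchart_change n c d z =
     (\<lambda>k\<in>tidx n. case k of
          Inl i \<Rightarrow> chart_change c d (base n z) i
        | Inr i \<Rightarrow> (\<Sum>j<n. jacobian c d (base n z) i j * z (Inr j)))"


section \<open>Finsler metrics\<close>

text \<open>A function on \<open>TM\<close> takes a base point and a tangent vector at it.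
  \<open>local_rep n A F c\<close> is such a function in the coordinates \<open>(x, y)\<close> induced by \<open>c\<close>.\<close>

definition local_rep ::
  "nat \<Rightarrow> 'p chart set \<Rightarrow> ('p \<Rightarrow> 'p tvec \<Rightarrow> real) \<Rightarrow> 'p chart \<Rightarrow> tcoords \<Rightarrow> real" where
  "local_rep n A F c z =
     (let p = chart_inv c (base n z) in F p (tvec_of n A c p (\<lambda>i. z (Inr i))))"

text \<open>From here on \<open>L\<close> is the coordinate expression of \<open>F\<close> in some chart.\<close>

definition fund_tensor :: "(tcoords \<Rightarrow> real) \<Rightarrow> nat \<Rightarrow> nat \<Rightarrow> tcoords \<Rightarrow> real" where
  "fund_tensor L i j z = 1/2 * dy i (dy j (\<lambda>w. (L w)\<^sup>2)) z"

definition finsler_metric :: "nat \<Rightarrow> 'p chart set \<Rightarrow> ('p \<Rightarrow> 'p tvec \<Rightarrow> real) \<Rightarrow> bool" where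
  "finsler_metric n A F \<longleftrightarrow>
     (\<forall>p \<in> (\<Union>c\<in>A. fst c). \<forall>v \<in> tangent_space n A p.
        0 \<le> F p v \<and> (\<forall>a>0. F p (tvec_scale n A p a v) = a * F p v)) \<and>
     (\<forall>c\<in>A. smooth_on (tidx n) (slit_dom n c) (local_rep n A F c)) \<and>
     (\<forall>c\<in>A. \<forall>z\<in>slit_dom n c. \<forall>u. (\<exists>i<n. u i \<noteq> 0) \<longrightarrow>
        0 < (\<Sum>i<n. \<Sum>j<n. fund_tensor (local_rep n A F c) i j z * u i * u j))"

text \<open>The entries \<open>g\<^sup>i\<^sup>l\<close> with both indices below \<open>n\<close> are uniquely determined wherever
  the fundamental tensor is invertible.\<close>

definition fund_tensor_inv :: "nat \<Rightarrow> (tcoords \<Rightarrow> real) \<Rightarrow> nat \<Rightarrow> nat \<Rightarrow> tcoords \<Rightarrow> real" where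
  "fund_tensor_inv n L i l z =
     (SOME h. \<forall>a<n. \<forall>b<n.
        (\<Sum>r<n. h a r * fund_tensor L r b z) = (if a = b then 1 else (0::real))) i l"

definition spray :: "nat \<Rightarrow> (tcoords \<Rightarrow> real) \<Rightarrow> nat \<Rightarrow> tcoords \<Rightarrow> real" where
  "spray n L i z =
     1/4 * (\<Sum>l<n. fund_tensor_inv n L i l z *
       ((\<Sum>k<n. dx k (dy l (\<lambda>w. (L w)\<^sup>2)) z * z (Inr k)) - dx l (\<lambda>w. (L w)\<^sup>2) z))"


section \<open>Douglas tensor and generalized $\tilde D$-metrics\<close>

text \<open>A tensor of type (1,3) is given by its components \<open>T j i k l\<close>, with \<open>i\<close> the upper index.
  \<open>G\<close> is the family of spray coefficients.\<close>

type_synonym tensor13 = "nat \<Rightarrow> nat \<Rightarrow> nat \<Rightarrow> nat \<Rightarrow> tcoords \<Rightarrow> real"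

definition berwald_h_deriv ::
  "nat \<Rightarrow> (nat \<Rightarrow> tcoords \<Rightarrow> real) \<Rightarrow> tensor13 \<Rightarrow> nat \<Rightarrow> tensor13" where
  "berwald_h_deriv n G T m j i k l z =
     dx m (T j i k l) z
     - (\<Sum>r<n. dy m (G r) z * dy r (T j i k l) z)
     + (\<Sum>r<n. T j r k l z * dy m (dy r (G i)) z)
     - (\<Sum>r<n. T r i k l z * dy m (dy j (G r)) z)
     - (\<Sum>r<n. T j i r l z * dy m (dy k (G r)) z)
     - (\<Sum>r<n. T j i k r z * dy m (dy l (G r)) z)"

definition berwald_deriv_0 :: "nat \<Rightarrow> (nat \<Rightarrow> tcoords \<Rightarrow> real) \<Rightarrow> tensor13 \<Rightarrow> tensor13" where
  "berwald_deriv_0 n G T j i k l z =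
     (\<Sum>m<n. berwald_h_deriv n G T m j i k l z * z (Inr m))"

definition douglas :: "nat \<Rightarrow> (nat \<Rightarrow> tcoords \<Rightarrow> real) \<Rightarrow> tensor13" where
  "douglas n G j i k l =
     dy j (dy k (dy l (\<lambda>z. G i z - 1 / (real n + 1) * (\<Sum>m<n. dy m (G m) z) * z (Inr i))))"

definition douglas_tilde :: "nat \<Rightarrow> (nat \<Rightarrow> tcoords \<Rightarrow> real) \<Rightarrow> tensor13" where
  "douglas_tilde n G = berwald_deriv_0 n G (douglas n G)"

text \<open>Smooth tensors of type (0,1) on \<open>TM\<^sub>0\<close>, given by their components in all charts.
  The components may depend on \<open>y\<close>, and no homogeneity in \<open>y\<close> is imposed.\<close>

definition covector_tensor ::
  "nat \<Rightarrow> 'p chart set \<Rightarrow> ('p chart \<Rightarrow> nat \<Rightarrow> tcoords \<Rightarrow> real) \<Rightarrow> bool" where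
  "covector_tensor n A \<mu> \<longleftrightarrow>
     (\<forall>c\<in>A. \<forall>r<n. smooth_on (tidx n) (slit_dom n c) (\<mu> c r)) \<and>
     (\<forall>c\<in>A. \<forall>d\<in>A. \<forall>z\<in>slit_dom n c. base n z \<in> snd c ` (fst c \<inter> fst d) \<longrightarrow>
        (\<forall>r<n. \<mu> c r z = (\<Sum>s<n. jacobian c d (base n z) s r * \<mu> d s (tchart_change n c d z))))"

definition generalized_D_tilde_metric ::
  "nat \<Rightarrow> 'p chart set \<Rightarrow> ('p \<Rightarrow> 'p tvec \<Rightarrow> real) \<Rightarrow> bool" where
  "generalized_D_tilde_metric n A F \<longleftrightarrow>
     (\<exists>\<mu>. covector_tensor n A \<mu> \<and>
       (\<forall>c\<in>A. \<forall>z\<in>slit_dom n c. \<forall>j<n. \<forall>i<n. \<forall>k<n. \<forall>l<n.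
          let G = spray n (local_rep n A F c); D = douglas_tilde n G in
            berwald_deriv_0 n G D j i k l z
              + (\<Sum>r<n. \<mu> c r z * D j r k l z) * z (Inr i) = 0))"


section \<open>Weyl curvature\<close>

definition riemann :: "nat \<Rightarrow> (nat \<Rightarrow> tcoords \<Rightarrow> real) \<Rightarrow> nat \<Rightarrow> nat \<Rightarrow> tcoords \<Rightarrow> real" where
  "riemann n G i k z =
     2 * dx k (G i) z
     - (\<Sum>m<n. dx m (dy k (G i)) z * z (Inr m))
     + 2 * (\<Sum>m<n. G m z * dy m (dy k (G i)) z)
     - (\<Sum>m<n. dy m (G i) z * dy k (G m) z)"

definition weyl_A :: "nat \<Rightarrow> (nat \<Rightarrow> tcoords \<Rightarrow> real) \<Rightarrow> nat \<Rightarrow> nat \<Rightarrow> tcoords \<Rightarrow> real" where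
  "weyl_A n G i k z =
     riemann n G i k z
     - 1 / (real n - 1) * (\<Sum>m<n. riemann n G m m z) * (if i = k then 1 else 0)"

definition weyl_curvature ::
  "nat \<Rightarrow> (nat \<Rightarrow> tcoords \<Rightarrow> real) \<Rightarrow> nat \<Rightarrow> nat \<Rightarrow> tcoords \<Rightarrow> real" where
  "weyl_curvature n G i k z =
     weyl_A n G i k z - 1 / (real n + 1) * (\<Sum>m<n. dy m (weyl_A n G m k) z) * z (Inr i)"

definition weyl_metric :: "nat \<Rightarrow> 'p chart set \<Rightarrow> ('p \<Rightarrow> 'p tvec \<Rightarrow> real) \<Rightarrow> bool" where
  "weyl_metric n A F \<longleftrightarrow>
     finsler_metric n A F \<and>
     (\<forall>c\<in>A. \<forall>z\<in>slit_dom n c. \<forall>i<n. \<forall>k<n.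
        weyl_curvature n (spray n (local_rep n A F c)) i k z = 0)"

end

theory Submission
  imports Defs
begin

text \<open>
  In dimension two every spray that is smooth and positively homogeneous of degree two has vanishing
  Weyl curvature, so it suffices to find a Finsler surface that is not a generalized
  D-tilde-metric. Take the Randers metric \<open>F = |y| + (x\<^sup>0)\<^sup>3 y\<^sup>1\<close> on the strip \<open>|x\<^sup>0| < 1\<close>, with
  coordinates numbered from \<open>0\<close>. Its spray is \<open>P y\<^sup>i + 3/2 (x\<^sup>0)\<^sup>2 |y| m\<^sup>i\<close>, where \<open>m = (- y\<^sup>1, y\<^sup>0)\<close>;
  the first summand does not contribute to the Douglas tensor, which is therefore \<open>(x\<^sup>0)\<^sup>2\<close> times
  a tensor \<open>E\<close> depending on \<open>y\<close> only. Along \<open>x\<^sup>0 = 0\<close> the spray and the Douglas tensor vanish, and so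
  does its first covariant derivative along \<open>y\<close>, whereas the second one is \<open>2 (y\<^sup>0)\<^sup>2 E\<close>, which
  is nonzero at \<open>y = (1, 0)\<close>. No choice of \<open>\<mu>\<close> can compensate this.
\<close>

subsection \<open>Smooth functions of finitely many coordinates\<close>

text \<open>Changing one coordinate is a continuous map into the power topology, because
  \<open>k \<in> I\<close> keeps the point extensional. Hence \<open>pd\<close> on an open set is a
  local notion: only the values on \<open>U\<close> matter.\<close>

lemma eventually_upd_in_openin:
  assumes "openin (powertop_real I) U" "z \<in> U" "k \<in> I"
  shows "\<forall>\<^sub>F t in nhds (z k). z(k := t) \<in> U"
proof -
  have z: "z \<in> PiE I (\<lambda>_. UNIV)"
    using openin_subset[OF assms(1)] assms(2) by auto
  have "continuous_map euclideanreal (powertop_real I) (\<lambda>t. z(k := t))"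
    unfolding continuous_map_componentwise
  proof (intro conjI ballI)
    show "(\<lambda>t. z(k := t)) ` topspace euclideanreal \<subseteq> extensional I"
      using z assms(3) by (auto simp: PiE_def extensional_def)
    show "continuous_map euclideanreal euclideanreal (\<lambda>t. (z(k := t)) j)" if "j \<in> I" for j
      by (cases "j = k") auto
  qed
  then have "open {t. z(k := t) \<in> U}"
    using openin_continuous_map_preimage[OF _ assms(1)] by fastforce
  then show ?thesis
    using eventually_nhds_in_open[of "{t. z(k := t) \<in> U}" "z k"] assms(2) by simp
qed

lemma pd_cong:
  assumes "openin (powertop_real I) U" "z \<in> U" "k \<in> I" "\<And>w. w \<in> U \<Longrightarrow> f w = g w"
  shows "pd k f z = pd k g z"
  unfolding pd_def
  by (rule deriv_cong_ev[OF eventually_mono[OF eventually_upd_in_openin[OF assms(1-3)]]])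
    (use assms in auto)

lemma DERIV_upd_cong:
  assumes "openin (powertop_real I) U" "z \<in> U" "k \<in> I" "\<And>w. w \<in> U \<Longrightarrow> f w = g w"
  shows "((\<lambda>t. f (z(k := t))) has_real_derivative D) (at (z k))
    \<longleftrightarrow> ((\<lambda>t. g (z(k := t))) has_real_derivative D) (at (z k))"
  by (rule DERIV_cong_ev[OF refl eventually_mono[OF eventually_upd_in_openin[OF assms(1-3)]] refl])
    (use assms in auto)

text \<open>Only the coordinate line through \<open>z\<close> is constrained, so this also applies
  to functions that vanish merely on a hypersurface containing that line.\<close>

lemma pd_eq_zero_if_locally_zero:
  assumes "openin (powertop_real I) U" "z \<in> U" "k \<in> I" "\<And>t. z(k := t) \<in> U \<Longrightarrow> f (z(k := t)) = 0"
  shows "pd k f z = 0"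
proof -
  have "deriv (\<lambda>t. f (z(k := t))) (z k) = deriv (\<lambda>_. 0) (z k)"
    by (rule deriv_cong_ev[OF eventually_mono[OF eventually_upd_in_openin[OF assms(1-3)]]])
      (use assms in auto)
  then show ?thesis by (simp add: pd_def)
qed

section \<open>Closure properties of functions of class C^m\<close>

lemma C_k_on_continuous:
  "C_k_on I m U f \<Longrightarrow> continuous_map (subtopology (powertop_real I) U) euclideanreal f"
  by (cases m) auto

lemma C_k_on_Suc_imp: "C_k_on I (Suc m) U f \<Longrightarrow> C_k_on I m U f"
  by (induction m arbitrary: f) auto

text \<open>Derivatives are known by formulas valid on \<open>U\<close> only, while
  \<open>pd\<close> yields a total function; openness of \<open>U\<close> makes the values elsewhere
  irrelevant at every order.\<close>

lemma C_k_on_cong: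
  assumes "openin (powertop_real I) U" "\<And>w. w \<in> U \<Longrightarrow> f w = g w"
  shows "C_k_on I m U f \<longleftrightarrow> C_k_on I m U g"
  using assms(2)
proof (induction m arbitrary: f g)
  case 0
  then show ?case
    by (auto intro: continuous_map_eq[where f = f] continuous_map_eq[where f = g])
next
  case (Suc m)
  have "continuous_map (subtopology (powertop_real I) U) euclideanreal f
     \<longleftrightarrow> continuous_map (subtopology (powertop_real I) U) euclideanreal g"
    using Suc.prems by (auto intro: continuous_map_eq[where f = f] continuous_map_eq[where f = g])
  moreover have "(\<lambda>t. f (z(k := t))) differentiable at (z k)
      \<longleftrightarrow> (\<lambda>t. g (z(k := t))) differentiable at (z k)" if "k \<in> I" "z \<in> U" for k z
    using DERIV_upd_cong[OF assms(1) that(2,1), of f g] Suc.prems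
    by (simp add: real_differentiable_def)
  moreover have "C_k_on I m U (pd k f) \<longleftrightarrow> C_k_on I m U (pd k g)" if "k \<in> I" for k
    using pd_cong[OF assms(1) _ that] Suc.prems by (intro Suc.IH) blast
  ultimately show ?case by auto
qed

text \<open>This is the induction step of all closure proofs: a formula for the first derivatives on
  \<open>U\<close> lowers the order by one.\<close>

lemma C_k_on_SucI:
  assumes "openin (powertop_real I) U"
    and "continuous_map (subtopology (powertop_real I) U) euclideanreal f"
    and D: "\<And>k z. k \<in> I \<Longrightarrow> z \<in> U \<Longrightarrow> ((\<lambda>t. f (z(k := t))) has_real_derivative f' k z) (at (z k))"
    and "\<And>k. k \<in> I \<Longrightarrow> C_k_on I m U (f' k)"
  shows "C_k_on I (Suc m) U f"
proof -
  have "C_k_on I m U (pd k f)" if "k \<in> I" for k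
    using C_k_on_cong[OF assms(1), of "pd k f" "f' k"] DERIV_imp_deriv[OF D] assms(4) that
    by (simp add: pd_def)
  then show ?thesis
    using assms(2) D by (auto simp: real_differentiable_def)
qed

lemma C_k_on_SucD:
  assumes "C_k_on I (Suc m) U f" "k \<in> I" "z \<in> U"
  shows "((\<lambda>t. f (z(k := t))) has_real_derivative pd k f z) (at (z k))"
  using assms DERIV_deriv_iff_real_differentiable unfolding pd_def by auto

lemma C_k_on_const: "C_k_on I m U (\<lambda>_. c)"
proof (induction m arbitrary: c)
  case (Suc m)
  have "pd k (\<lambda>_. c) = (\<lambda>_. 0)" for k :: 'a
    by (simp add: pd_def fun_eq_iff)
  with Suc show ?case by simp
qed simp

lemma C_k_on_coord:
  assumes "j \<in> I"
  shows "C_k_on I m U (\<lambda>z. z j)"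
proof -
  have c: "continuous_map (subtopology (powertop_real I) U) euclideanreal (\<lambda>z. z j)"
    using assms by (intro continuous_map_from_subtopology continuous_map_product_projection)
  have "pd k (\<lambda>z. z j) = (\<lambda>_. if k = j then 1 else 0)" for k
    by (auto simp: pd_def fun_eq_iff)
  then have "C_k_on I m U (pd k (\<lambda>z. z j))" for k m
    by (simp add: C_k_on_const)
  moreover have "(\<lambda>t. (z(k := t)) j) differentiable at (z k)" for k and z :: "'a \<Rightarrow> real"
    by (cases "k = j") auto
  ultimately show ?thesis
    using c by (cases m) auto
qed

lemma C_k_on_add:
  assumes "openin (powertop_real I) U"
  shows "C_k_on I m U f \<Longrightarrow> C_k_on I m U g \<Longrightarrow> C_k_on I m U (\<lambda>z. f z + g z)"
proof (induction m arbitrary: f g)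
  case 0
  then show ?case by (auto intro: continuous_map_add)
next
  case (Suc m)
  show ?case
  proof (rule C_k_on_SucI[OF assms, where f' = "\<lambda>k z. pd k f z + pd k g z"])
    show "C_k_on I m U (\<lambda>z. pd k f z + pd k g z)" if "k \<in> I" for k
      using Suc that by auto
    show "((\<lambda>t. f (z(k := t)) + g (z(k := t))) has_real_derivative pd k f z + pd k g z) (at (z k))"
      if "k \<in> I" "z \<in> U" for k z
      using DERIV_add C_k_on_SucD[OF Suc.prems(1) that] C_k_on_SucD[OF Suc.prems(2) that] by blast
  qed (intro continuous_map_add C_k_on_continuous[OF Suc.prems(1)] C_k_on_continuous[OF Suc.prems(2)])
qed

lemma C_k_on_mult:
  assumes "openin (powertop_real I) U"
  shows "C_k_on I m U f \<Longrightarrow> C_k_on I m U g \<Longrightarrow> C_k_on I m U (\<lambda>z. f z * g z)"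
proof (induction m arbitrary: f g)
  case 0
  then show ?case by (auto intro: continuous_map_real_mult)
next
  case (Suc m)
  show ?case
  proof (rule C_k_on_SucI[OF assms, where f' = "\<lambda>k z. pd k f z * g z + pd k g z * f z"])
    show "C_k_on I m U (\<lambda>z. pd k f z * g z + pd k g z * f z)" if "k \<in> I" for k
      using Suc.prems that C_k_on_Suc_imp[OF Suc.prems(1)] C_k_on_Suc_imp[OF Suc.prems(2)]
      by (intro C_k_on_add[OF assms] Suc.IH) auto
    show "((\<lambda>t. f (z(k := t)) * g (z(k := t))) has_real_derivative
        pd k f z * g z + pd k g z * f z) (at (z k))" if "k \<in> I" "z \<in> U" for k z
      using DERIV_mult[OF C_k_on_SucD[OF Suc.prems(1) that] C_k_on_SucD[OF Suc.prems(2) that]]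
      unfolding fun_upd_triv .
  qed (intro continuous_map_real_mult C_k_on_continuous[OF Suc.prems(1)] C_k_on_continuous[OF Suc.prems(2)])
qed

text \<open>The derivative is written as a product of constants, the inner derivative and inverses,
  so that closure under products applies to it verbatim. The separate \<open>c\<close> absorbs the
  trivial update in \<open>f (z(k := z k))\<close>. The square root below is treated
  likewise.\<close>

lemma DERIV_inverse_eq:
  assumes "(f has_real_derivative D) (at x)" "f x = c" "c \<noteq> 0"
  shows "((\<lambda>t. inverse (f t)) has_real_derivative (- 1) * D * (inverse c * inverse c)) (at x)"
  using DERIV_inverse'[OF assms(1)] assms(2,3) by (simp add: mult_ac)

lemma DERIV_sqrt_eq:
  assumes "(f has_real_derivative D) (at x)" "f x = c" "0 < c"
  shows "((\<lambda>t. sqrt (f t)) has_real_derivative D * ((1/2) * inverse (sqrt c))) (at x)"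
  using DERIV_chain2[OF DERIV_real_sqrt[of "f x"] assms(1)] assms(2,3) by (simp add: field_simps)

lemma C_k_on_inverse:
  assumes "openin (powertop_real I) U" "\<And>z. z \<in> U \<Longrightarrow> f z \<noteq> 0"
  shows "C_k_on I m U f \<Longrightarrow> C_k_on I m U (\<lambda>z. inverse (f z))"
proof (induction m)
  case 0
  then show ?case using assms by (auto intro!: continuous_map_real_inverse)
next
  case (Suc m)
  show ?case
  proof (rule C_k_on_SucI[OF assms(1), where f' = "\<lambda>k z. (- 1) * pd k f z * (inverse (f z) * inverse (f z))"])
    show "C_k_on I m U (\<lambda>z. (- 1) * pd k f z * (inverse (f z) * inverse (f z)))" if "k \<in> I" for k
      using Suc.prems that C_k_on_Suc_imp[OF Suc.prems]
      by (intro C_k_on_mult[OF assms(1)] C_k_on_const Suc.IH) auto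
    show "((\<lambda>t. inverse (f (z(k := t)))) has_real_derivative
        (- 1) * pd k f z * (inverse (f z) * inverse (f z))) (at (z k))" if "k \<in> I" "z \<in> U" for k z
      by (rule DERIV_inverse_eq[OF C_k_on_SucD[OF Suc.prems that]])
        (simp_all only: fun_upd_triv assms(2)[OF that(2)] not_False_eq_True)
  qed (intro continuous_map_real_inverse C_k_on_continuous[OF Suc.prems], use assms in auto)
qed

lemma C_k_on_sqrt:
  assumes "openin (powertop_real I) U" "\<And>z. z \<in> U \<Longrightarrow> 0 < f z"
  shows "C_k_on I m U f \<Longrightarrow> C_k_on I m U (\<lambda>z. sqrt (f z))"
proof (induction m)
  case 0
  then show ?case by (auto intro: continuous_map_sqrt)
next
  case (Suc m)
  show ?case
  proof (rule C_k_on_SucI[OF assms(1), where f' = "\<lambda>k z. pd k f z * ((1/2) * inverse (sqrt (f z)))"])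
    show "C_k_on I m U (\<lambda>z. pd k f z * ((1/2) * inverse (sqrt (f z))))" if "k \<in> I" for k
      using Suc.prems that C_k_on_Suc_imp[OF Suc.prems] assms(2)
      by (intro C_k_on_mult[OF assms(1)] C_k_on_const C_k_on_inverse[OF assms(1)] Suc.IH)
        (auto simp: less_imp_neq[symmetric])
    show "((\<lambda>t. sqrt (f (z(k := t)))) has_real_derivative
        pd k f z * ((1/2) * inverse (sqrt (f z)))) (at (z k))" if "k \<in> I" "z \<in> U" for k z
      by (rule DERIV_sqrt_eq[OF C_k_on_SucD[OF Suc.prems that]])
        (simp_all only: fun_upd_triv assms(2)[OF that(2)])
  qed (intro continuous_map_sqrt C_k_on_continuous[OF Suc.prems])
qed

section \<open>Smooth functions and the rules for partial derivatives\<close>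

lemma smooth_on_has_pd:
  assumes "smooth_on I U f" "k \<in> I" "z \<in> U"
  shows "((\<lambda>t. f (z(k := t))) has_real_derivative pd k f z) (at (z k))"
  using assms C_k_on_SucD[of I 0] unfolding smooth_on_def by blast

lemma smooth_on_continuous:
  "smooth_on I U f \<Longrightarrow> continuous_map (subtopology (powertop_real I) U) euclideanreal f"
  using C_k_on_continuous smooth_on_def by blast

lemma smooth_on_pd: "smooth_on I U f \<Longrightarrow> k \<in> I \<Longrightarrow> smooth_on I U (pd k f)"
  unfolding smooth_on_def
proof
  fix m
  assume "\<forall>m. C_k_on I m U f" "k \<in> I"
  then have "C_k_on I (Suc m) U f" "k \<in> I" by blast+
  then show "C_k_on I m U (pd k f)" by simp
qed

lemma smooth_on_cong:
  assumes "openin (powertop_real I) U" "\<And>w. w \<in> U \<Longrightarrow> f w = g w"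
  shows "smooth_on I U f \<longleftrightarrow> smooth_on I U g"
  using C_k_on_cong[OF assms] by (simp add: smooth_on_def)

lemma smooth_on_const: "smooth_on I U (\<lambda>_. c)"
  by (simp add: smooth_on_def C_k_on_const)

lemma smooth_on_coord: "j \<in> I \<Longrightarrow> smooth_on I U (\<lambda>z. z j)"
  by (simp add: smooth_on_def C_k_on_coord)

context
  fixes I :: "'k set" and U :: "('k \<Rightarrow> real) set"
  assumes U: "openin (powertop_real I) U"
begin

lemma smooth_on_add: "smooth_on I U f \<Longrightarrow> smooth_on I U g \<Longrightarrow> smooth_on I U (\<lambda>z. f z + g z)"
  by (simp add: smooth_on_def C_k_on_add[OF U])

lemma smooth_on_mult: "smooth_on I U f \<Longrightarrow> smooth_on I U g \<Longrightarrow> smooth_on I U (\<lambda>z. f z * g z)"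
  by (simp add: smooth_on_def C_k_on_mult[OF U])

lemma smooth_on_diff: "smooth_on I U f \<Longrightarrow> smooth_on I U g \<Longrightarrow> smooth_on I U (\<lambda>z. f z - g z)"
  using smooth_on_add[OF _ smooth_on_mult[OF smooth_on_const, of g "- 1"], of f] by simp

lemma smooth_on_uminus: "smooth_on I U f \<Longrightarrow> smooth_on I U (\<lambda>z. - f z)"
  using smooth_on_diff[OF smooth_on_const, of f 0] by simp

lemma smooth_on_sum: "(\<And>a. a \<in> S \<Longrightarrow> smooth_on I U (f a)) \<Longrightarrow> smooth_on I U (\<lambda>z. \<Sum>a\<in>S. f a z)"
  by (induction S rule: infinite_finite_induct) (auto intro: smooth_on_const smooth_on_add)

lemma smooth_on_power: "smooth_on I U f \<Longrightarrow> smooth_on I U (\<lambda>z. f z ^ m)"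
  by (induction m) (auto intro: smooth_on_const smooth_on_mult)

lemma smooth_on_divide:
  "smooth_on I U f \<Longrightarrow> smooth_on I U g \<Longrightarrow> (\<And>z. z \<in> U \<Longrightarrow> g z \<noteq> 0) \<Longrightarrow>
    smooth_on I U (\<lambda>z. f z / g z)"
  unfolding divide_inverse by (intro smooth_on_mult) (simp_all add: smooth_on_def C_k_on_inverse[OF U])

lemma smooth_on_sqrt:
  "smooth_on I U f \<Longrightarrow> (\<And>z. z \<in> U \<Longrightarrow> 0 < f z) \<Longrightarrow> smooth_on I U (\<lambda>z. sqrt (f z))"
  by (simp add: smooth_on_def C_k_on_sqrt[OF U])

lemma smooth_on_divide_const: "smooth_on I U f \<Longrightarrow> smooth_on I U (\<lambda>z. f z / c)"
  unfolding divide_inverse by (intro smooth_on_mult smooth_on_const)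

lemma pd_add:
  "smooth_on I U f \<Longrightarrow> smooth_on I U g \<Longrightarrow> k \<in> I \<Longrightarrow> z \<in> U \<Longrightarrow>
    pd k (\<lambda>z. f z + g z) z = pd k f z + pd k g z"
  unfolding pd_def[of k "\<lambda>z. f z + g z"] by (rule DERIV_imp_deriv[OF DERIV_add[OF smooth_on_has_pd[of I U f k z] smooth_on_has_pd[of I U g k z]]])

lemma pd_diff:
  "smooth_on I U f \<Longrightarrow> smooth_on I U g \<Longrightarrow> k \<in> I \<Longrightarrow> z \<in> U \<Longrightarrow>
    pd k (\<lambda>z. f z - g z) z = pd k f z - pd k g z"
  unfolding pd_def[of k "\<lambda>z. f z - g z"] by (rule DERIV_imp_deriv[OF DERIV_diff[OF smooth_on_has_pd[of I U f k z] smooth_on_has_pd[of I U g k z]]])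

lemma pd_uminus:
  "smooth_on I U f \<Longrightarrow> k \<in> I \<Longrightarrow> z \<in> U \<Longrightarrow> pd k (\<lambda>z. - f z) z = - pd k f z"
  unfolding pd_def[of k "\<lambda>z. - f z"]
  by (rule DERIV_imp_deriv[OF DERIV_minus[OF smooth_on_has_pd[of I U f k z]]])

lemma pd_divide_const:
  "smooth_on I U f \<Longrightarrow> k \<in> I \<Longrightarrow> z \<in> U \<Longrightarrow> pd k (\<lambda>z. f z / c) z = pd k f z / c"
  unfolding pd_def[of k "\<lambda>z. f z / c"]
  by (rule DERIV_imp_deriv[OF DERIV_cdivide[OF smooth_on_has_pd[of I U f k z]]])

lemma pd_sum:
  "(\<And>a. a \<in> S \<Longrightarrow> smooth_on I U (f a)) \<Longrightarrow> k \<in> I \<Longrightarrow> z \<in> U \<Longrightarrow>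
    pd k (\<lambda>z. \<Sum>a\<in>S. f a z) z = (\<Sum>a\<in>S. pd k (f a) z)"
  unfolding pd_def[of k "\<lambda>z. \<Sum>a\<in>S. f a z"]
  by (rule DERIV_imp_deriv[OF DERIV_sum[OF smooth_on_has_pd[of I U "f a" k z for a]]])

lemma pd_mult:
  "smooth_on I U f \<Longrightarrow> smooth_on I U g \<Longrightarrow> k \<in> I \<Longrightarrow> z \<in> U \<Longrightarrow>
    pd k (\<lambda>z. f z * g z) z = pd k f z * g z + f z * pd k g z"
  using DERIV_imp_deriv[OF DERIV_mult[OF smooth_on_has_pd[of I U f k z] smooth_on_has_pd[of I U g k z]]]
  unfolding pd_def[of k "\<lambda>z. f z * g z"] by simp

end

lemma pd_const: "pd k (\<lambda>_. c) z = 0"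
  by (simp add: pd_def)

lemma pd_coord: "pd k (\<lambda>z. z j) z = (if k = j then 1 else 0)"
  by (auto simp: pd_def)

text \<open>Continuous partial derivatives give total differentiability in two coordinates. This is
  what the chain rule along a ray in the fibre requires.\<close>

lemma smooth_on_has_derivative_two:
  assumes U: "openin (powertop_real I) U" and f: "smooth_on I U f"
    and k: "k \<in> I" and l: "l \<in> I" and "k \<noteq> l" and z: "z \<in> U"
  shows "((\<lambda>(a, b). f (z(k := a, l := b))) has_derivative (\<lambda>(s, t). s * pd k f z + t * pd l f z))
    (at (z k, z l))"
proof -
  define p where "p = (\<lambda>w. z(k := fst w, l := snd w))"
  have zE: "z \<in> PiE I (\<lambda>_. UNIV)"
    using openin_subset[OF U] z by auto
  have p: "continuous_map euclidean (powertop_real I) p"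
    unfolding continuous_map_componentwise
  proof (intro conjI ballI)
    show "p ` topspace euclidean \<subseteq> extensional I"
      using zE k l by (auto simp: p_def PiE_def extensional_def)
    show "continuous_map euclidean euclideanreal (\<lambda>w. p w j)" for j
    proof -
      consider "j = l" | "j = k" "j \<noteq> l" | "j \<noteq> k" "j \<noteq> l" by blast
      then show ?thesis
        by cases (auto simp: p_def intro: continuous_intros)
    qed
  qed
  define W where "W = {w. p w \<in> U}"
  have "open W"
    using openin_continuous_map_preimage[OF p U] by (simp add: W_def)
  moreover have "(z k, z l) \<in> W"
    using z by (simp add: W_def p_def)
  ultimately obtain X Y' where XY': "open X" "open Y'" "(z k, z l) \<in> X \<times> Y'" "X \<times> Y' \<subseteq> W"
    by (rule open_prod_elim)
  \<comment> \<open>The criterion by partial derivatives needs a convex range for the second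
    variable, hence the ball.\<close>
  then obtain e where e: "0 < e" "ball (z l) e \<subseteq> Y'"
    by (meson mem_Sigma_iff open_contains_ball)
  define Y where "Y = ball (z l) e"
  have Y: "X \<times> Y \<subseteq> W" "z l \<in> Y" "open Y" "convex Y"
    using XY' e by (auto simp: Y_def)
  have cont: "continuous_on W (\<lambda>w. pd l f (p w))"
  proof -
    have "continuous_map (subtopology euclidean W) (subtopology (powertop_real I) U) p"
      using p by (auto simp: continuous_map_in_subtopology W_def intro: continuous_map_from_subtopology)
    from continuous_map_compose[OF this smooth_on_continuous[OF smooth_on_pd[OF f l]]]
    show ?thesis by (simp add: o_def)
  qed
  have "((\<lambda>(a, b). f (z(k := a, l := b))) has_derivative
      (\<lambda>(s, t). pd k f z * s + blinfun_mult_right (pd l f (p (z k, z l))) t)) (at (z k, z l) within X \<times> Y)"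
  proof (rule has_derivative_partialsI[where fy = "\<lambda>a b. blinfun_mult_right (pd l f (p (a, b)))"])
    \<comment> \<open>In the first variable differentiability at the point suffices; in the second
      the derivative must exist on all of \<open>X \<times> Y\<close> and be continuous at the
      point.\<close>
    have "(\<lambda>a. f (z(k := a, l := z l))) = (\<lambda>a. f (z(k := a)))"
      by (rule ext, rule arg_cong[where f = f]) (use \<open>k \<noteq> l\<close> in auto)
    then show "((\<lambda>a. f (z(k := a, l := z l))) has_derivative (*) (pd k f z)) (at (z k) within X)"
      using smooth_on_has_pd[OF f k z] by (simp add: has_field_derivative_def has_derivative_at_withinI)
    show "((\<lambda>b. f (z(k := a, l := b))) has_derivative blinfun_apply (blinfun_mult_right (pd l f (p (a, b)))))
        (at b within Y)" if "a \<in> X" "b \<in> Y" for a b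
    proof -
      have "p (a, b) \<in> U" using that Y(1) by (auto simp: W_def)
      from smooth_on_has_pd[OF f l this] show ?thesis
        by (auto simp: p_def has_field_derivative_def intro: has_derivative_at_withinI)
    qed
    have "continuous_on (X \<times> Y) (\<lambda>w. pd l f (p w))"
      using cont Y(1) continuous_on_subset by blast
    then have "continuous_on (X \<times> Y) (\<lambda>w. blinfun_mult_right (pd l f (p w)))"
      by (intro bounded_linear.continuous_on[OF bounded_linear_blinfun_mult_right])
    then show "continuous (at (z k, z l) within X \<times> Y) (\<lambda>(a, b). blinfun_mult_right (pd l f (p (a, b))))"
      using XY'(3) Y(2) by (simp add: continuous_on_eq_continuous_within case_prod_unfold)
  qed (use Y in auto)
  moreover have "at (z k, z l) within X \<times> Y = at (z k, z l)"
    using XY' Y by (intro at_within_open) (auto simp: open_Times)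
  moreover have "p (z k, z l) = z" by (simp add: p_def)
  ultimately show ?thesis by (simp add: mult.commute)
qed

subsection \<open>Positively homogeneous functions on the slit tangent bundle\<close>

text \<open>The dilation of the fibres. The restriction to \<open>tidx n\<close> keeps the result
  extensional, so that it stays in the coordinate domain.\<close>

definition fibre_scale :: "nat \<Rightarrow> real \<Rightarrow> tcoords \<Rightarrow> tcoords" where
  "fibre_scale n a z = (\<lambda>k\<in>tidx n. case k of Inl _ \<Rightarrow> z k | Inr _ \<Rightarrow> a * z k)"

definition homogeneous_on :: "nat \<Rightarrow> tcoords set \<Rightarrow> nat \<Rightarrow> (tcoords \<Rightarrow> real) \<Rightarrow> bool" where
  "homogeneous_on n U d f \<longleftrightarrow> (\<forall>z\<in>U. \<forall>a>0. f (fibre_scale n a z) = a ^ d * f z)"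

lemma fibre_scale_Inl [simp]: "i < n \<Longrightarrow> fibre_scale n a z (Inl i) = z (Inl i)"
  and fibre_scale_Inr [simp]: "i < n \<Longrightarrow> fibre_scale n a z (Inr i) = a * z (Inr i)"
  by (simp_all add: fibre_scale_def InlI InrI)

lemma base_fibre_scale [simp]: "base n (fibre_scale n a z) = base n z"
  by (auto simp: base_def)

lemma fibre_scale_in_slit_dom: "z \<in> slit_dom n c \<Longrightarrow> 0 < a \<Longrightarrow> fibre_scale n a z \<in> slit_dom n c"
  unfolding slit_dom_def mem_Collect_eq base_fibre_scale
proof (elim conjE exE, intro conjI)
  fix i
  assume "i < n" "z (Inr i) \<noteq> 0" "0 < a"
  then show "\<exists>i<n. fibre_scale n a z (Inr i) \<noteq> 0"
    by (intro exI[of _ i]) simp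
qed (simp_all add: fibre_scale_def)

lemma fibre_scale_upd_Inr:
  "k < n \<Longrightarrow> (fibre_scale n a z)(Inr k := a * t) = fibre_scale n a (z(Inr k := t))"
  by (auto simp: fibre_scale_def fun_eq_iff split: sum.split)

lemma fibre_scale_upd_Inl:
  "k < n \<Longrightarrow> (fibre_scale n a z)(Inl k := t) = fibre_scale n a (z(Inl k := t))"
  by (auto simp: fibre_scale_def fun_eq_iff split: sum.split)

text \<open>The slit domain is the preimage of the open chart image under \<open>base n\<close>,
  intersected with the union of the open sets on which a single fibre coordinate is nonzero.\<close>

lemma openin_slit_dom:
  assumes "openin (powertop_real {..<n}) (snd c ` fst c)"
  shows "openin (powertop_real (tidx n)) (slit_dom n c)"
proof -
  let ?T = "powertop_real (tidx n)"
  have "continuous_map ?T (powertop_real {..<n}) (base n)"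
    unfolding continuous_map_componentwise base_def
    by (auto intro!: continuous_map_product_projection)
  from openin_continuous_map_preimage[OF this assms]
  have 1: "openin ?T {z \<in> topspace ?T. base n z \<in> snd c ` fst c}" .
  have "openin ?T {z \<in> topspace ?T. z (Inr i) \<in> - {0}}" if "i < n" for i
    by (rule openin_continuous_map_preimage[where Y = euclideanreal])
      (use that in \<open>auto intro!: continuous_map_product_projection open_Compl\<close>)
  then have "openin ?T (\<Union>i<n. {z \<in> topspace ?T. z (Inr i) \<in> - {0}})"
    by blast
  from openin_Int[OF 1 this] show ?thesis
    by (rule back_subst[of "openin ?T"]) (auto simp: slit_dom_def)
qed

locale slit_domain =
  fixes n :: nat and c :: "'p chart" and U :: "tcoords set"
  assumes openin_image: "openin (powertop_real {..<n}) (snd c ` fst c)"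
    and U_def: "U = slit_dom n c"
    and n_pos: "0 < n"
begin

lemma openin_U: "openin (powertop_real (tidx n)) U"
  using openin_slit_dom[OF openin_image] by (simp add: U_def)

lemma fibre_scale_in_U: "z \<in> U \<Longrightarrow> 0 < a \<Longrightarrow> fibre_scale n a z \<in> U"
  by (simp add: U_def fibre_scale_in_slit_dom)

lemmas smooth_intros = smooth_on_const smooth_on_coord smooth_on_add[OF openin_U]
  smooth_on_mult[OF openin_U] smooth_on_diff[OF openin_U] smooth_on_sum[OF openin_U] smooth_on_pd

text \<open>Differentiating the homogeneity relation in a fibre coordinate produces an extra factor
  \<open>a\<close> on the scaled side; cancelling it lowers the degree by one.\<close>

lemma homogeneous_on_dy:
  assumes f: "smooth_on (tidx n) U f" and h: "homogeneous_on n U (Suc d) f" and "k < n"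
  shows "homogeneous_on n U d (dy k f)"
  unfolding homogeneous_on_def
proof (intro ballI allI impI)
  fix z and a :: real
  assume z: "z \<in> U" and a: "0 < a"
  have k: "Inr k \<in> tidx n" using \<open>k < n\<close> by auto
  let ?s = "fibre_scale n a"
  have "((\<lambda>s. f ((?s z)(Inr k := s))) has_real_derivative dy k f (?s z)) (at (?s z (Inr k)))"
    by (rule smooth_on_has_pd[OF f k fibre_scale_in_U[OF z a]])
  then have "((\<lambda>s. f ((?s z)(Inr k := s))) has_real_derivative dy k f (?s z)) (at (a * z (Inr k)))"
    using \<open>k < n\<close> by simp
  moreover have "((*) a has_real_derivative a) (at (z (Inr k)))"
    by (auto intro!: derivative_eq_intros)
  ultimately have "((\<lambda>t. f ((?s z)(Inr k := a * t))) has_real_derivative dy k f (?s z) * a) (at (z (Inr k)))"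
    by (rule DERIV_chain2)
  then have "((\<lambda>t. f (?s (z(Inr k := t)))) has_real_derivative dy k f (?s z) * a) (at (z (Inr k)))"
    by (simp only: fibre_scale_upd_Inr[OF \<open>k < n\<close>])
  then have "((\<lambda>t. a ^ Suc d * f (z(Inr k := t))) has_real_derivative dy k f (?s z) * a) (at (z (Inr k)))"
    using DERIV_upd_cong[OF openin_U z k, of "\<lambda>w. f (?s w)" "\<lambda>w. a ^ Suc d * f w" "dy k f (?s z) * a"]
      h a by (simp only: homogeneous_on_def)
  moreover have "((\<lambda>t. a ^ Suc d * f (z(Inr k := t))) has_real_derivative a ^ Suc d * dy k f z) (at (z (Inr k)))"
    by (rule DERIV_cmult[OF smooth_on_has_pd[OF f k z]])
  ultimately have "dy k f (?s z) * a = a ^ Suc d * dy k f z"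
    by (rule DERIV_unique)
  then show "dy k f (?s z) = a ^ d * dy k f z"
    using a by simp
qed

text \<open>The dilation leaves the base coordinates fixed, so no factor arises and the degree stays
  the same.\<close>

lemma homogeneous_on_dx:
  assumes f: "smooth_on (tidx n) U f" and h: "homogeneous_on n U d f" and "k < n"
  shows "homogeneous_on n U d (dx k f)"
  unfolding homogeneous_on_def
proof (intro ballI allI impI)
  fix z and a :: real
  assume z: "z \<in> U" and a: "0 < a"
  have k: "Inl k \<in> tidx n" using \<open>k < n\<close> by auto
  let ?s = "fibre_scale n a"
  have "((\<lambda>s. f ((?s z)(Inl k := s))) has_real_derivative dx k f (?s z)) (at (?s z (Inl k)))"
    by (rule smooth_on_has_pd[OF f k fibre_scale_in_U[OF z a]])
  then have "((\<lambda>t. f (?s (z(Inl k := t)))) has_real_derivative dx k f (?s z)) (at (z (Inl k)))"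
    by (simp only: fibre_scale_upd_Inl[OF \<open>k < n\<close>] fibre_scale_Inl[OF \<open>k < n\<close>])
  then have "((\<lambda>t. a ^ d * f (z(Inl k := t))) has_real_derivative dx k f (?s z)) (at (z (Inl k)))"
    using DERIV_upd_cong[OF openin_U z k, of "\<lambda>w. f (?s w)" "\<lambda>w. a ^ d * f w" "dx k f (?s z)"]
      h a by (simp only: homogeneous_on_def)
  moreover have "((\<lambda>t. a ^ d * f (z(Inl k := t))) has_real_derivative a ^ d * dx k f z) (at (z (Inl k)))"
    by (rule DERIV_cmult[OF smooth_on_has_pd[OF f k z]])
  ultimately show "dx k f (?s z) = a ^ d * dx k f z"
    by (rule DERIV_unique)
qed

lemma homogeneous_on_mult:
  "homogeneous_on n U d f \<Longrightarrow> homogeneous_on n U e g \<Longrightarrow> homogeneous_on n U (d + e) (\<lambda>z. f z * g z)"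
  by (simp add: homogeneous_on_def power_add)

lemma homogeneous_on_add:
  "homogeneous_on n U d f \<Longrightarrow> homogeneous_on n U d g \<Longrightarrow> homogeneous_on n U d (\<lambda>z. f z + g z)"
  by (simp add: homogeneous_on_def distrib_left)

lemma homogeneous_on_diff:
  "homogeneous_on n U d f \<Longrightarrow> homogeneous_on n U d g \<Longrightarrow> homogeneous_on n U d (\<lambda>z. f z - g z)"
  by (simp add: homogeneous_on_def right_diff_distrib)

lemma homogeneous_on_sum:
  "(\<And>b. b \<in> S \<Longrightarrow> homogeneous_on n U d (f b)) \<Longrightarrow> homogeneous_on n U d (\<lambda>z. \<Sum>b\<in>S. f b z)"
  by (simp add: homogeneous_on_def sum_distrib_left)

lemma homogeneous_on_cmult: "homogeneous_on n U d f \<Longrightarrow> homogeneous_on n U d (\<lambda>z. b * f z)"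
  by (simp add: homogeneous_on_def)

end

lemma sum_lessThan_2: "(\<Sum>m<2. f m) = f 0 + f (Suc 0)" for f :: "nat \<Rightarrow> 'b::comm_monoid_add"
  by (simp add: numeral_2_eq_2)

text \<open>Euler's relation: both sides are the derivative at t = 1 of f along the ray t y, once by
  the chain rule and once from the factor t^d.\<close>

lemma (in slit_domain) Euler_homogeneous_2:
  assumes n: "n = 2" and f: "smooth_on (tidx 2) U f" and h: "homogeneous_on 2 U d f" and z: "z \<in> U"
  shows "dy 0 f z * z (Inr 0) + dy (Suc 0) f z * z (Inr (Suc 0)) = real d * f z"
proof -
  let ?y = "z (Inr 0)" and ?y' = "z (Inr (Suc 0))"
  have zE: "z \<in> PiE (tidx 2) (\<lambda>_. UNIV)"
    using z n by (simp add: U_def slit_dom_def)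
  have "((\<lambda>(a, b). f (z(Inr 0 := a, Inr (Suc 0) := b))) has_derivative
      (\<lambda>(s, t). s * dy 0 f z + t * dy (Suc 0) f z)) (at (?y, ?y'))"
    by (rule smooth_on_has_derivative_two[OF _ f]) (use openin_U n z in auto)
  then have "((\<lambda>(a, b). f (z(Inr 0 := a, Inr (Suc 0) := b))) has_derivative
      (\<lambda>(s, t). s * dy 0 f z + t * dy (Suc 0) f z)) (at ((\<lambda>t. (t * ?y, t * ?y')) 1))"
    by simp
  moreover have "((\<lambda>t. (t * ?y, t * ?y')) has_derivative (\<lambda>h. (h * ?y, h * ?y'))) (at 1)"
    by (auto intro!: derivative_eq_intros)
  ultimately have "((\<lambda>t. (\<lambda>(a, b). f (z(Inr 0 := a, Inr (Suc 0) := b))) (t * ?y, t * ?y')) has_derivative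
      (\<lambda>h. (\<lambda>(s, t). s * dy 0 f z + t * dy (Suc 0) f z) (h * ?y, h * ?y'))) (at 1)"
    by (rule has_derivative_compose[rotated])
  then have "((\<lambda>t. f (z(Inr 0 := t * ?y, Inr (Suc 0) := t * ?y'))) has_real_derivative
      dy 0 f z * ?y + dy (Suc 0) f z * ?y') (at 1)"
    unfolding has_field_derivative_def prod.case
    by (rule back_subst[of "\<lambda>D. (_ has_derivative D) _"]) (auto simp: algebra_simps)
  moreover have "z(Inr 0 := t * ?y, Inr (Suc 0) := t * ?y') = fibre_scale 2 t z" for t
    using zE by (auto simp: fibre_scale_def fun_eq_iff PiE_def extensional_def less_2_cases_iff split: sum.split)
  ultimately have "((\<lambda>t. f (fibre_scale 2 t z)) has_real_derivative
      dy 0 f z * ?y + dy (Suc 0) f z * ?y') (at 1)"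
    by (simp only:)
  moreover have "((\<lambda>t. f (fibre_scale 2 t z)) has_real_derivative real d * f z) (at 1)"
  proof -
    have "((\<lambda>t. t ^ d * f z) has_real_derivative real d * f z) (at 1)"
      by (auto intro!: derivative_eq_intros)
    moreover have "\<forall>\<^sub>F t in nhds (1::real). t \<in> {0<..}"
      by (rule eventually_nhds_in_open) auto
    then have "\<forall>\<^sub>F t in nhds (1::real). f (fibre_scale 2 t z) = t ^ d * f z"
      by eventually_elim (use h z in \<open>auto simp: homogeneous_on_def\<close>)
    ultimately show ?thesis
      by (subst DERIV_cong_ev[OF refl _ refl])
  qed
  ultimately show ?thesis
    by (rule DERIV_unique)
qed


subsection \<open>Weyl curvature of surfaces\<close>

text \<open>Euler's theorem gives \<open>R\<^sup>i\<^sub>k y\<^sup>k = 0\<close>, which in dimension two forces \<open>A\<^sup>i\<^sub>k\<close>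
  to be a multiple of \<open>y\<^sup>i\<close>.\<close>

theorem (in slit_domain) weyl_curvature_surface_eq_0:
  assumes n: "n = 2"
    and smooth: "\<And>i. i < 2 \<Longrightarrow> smooth_on (tidx 2) U (G i)"
    and hom: "\<And>i. i < 2 \<Longrightarrow> homogeneous_on 2 U 2 (G i)"
    and z: "z \<in> U" and i: "i < 2" and k: "k < 2"
  shows "weyl_curvature 2 G i k z = 0"
proof -
  let ?S = "smooth_on (tidx 2) U" and ?y = "\<lambda>m w. w (Inr m) :: real"
  note U = openin_U[unfolded n]
  note intros = smooth_intros[unfolded n]
  have idx: "Inl m \<in> tidx 2" "Inr m \<in> tidx 2" if "m < 2" for m
    using that by auto
  have one: "Suc 0 < 2" "(0::nat) < 2" by auto
  have hdy: "homogeneous_on 2 U 1 (dy m (G r))" if "m < 2" "r < 2" for m r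
    using homogeneous_on_dy[of "G r" 1 m] that smooth hom n by (simp add: numeral_2_eq_2)
  have euler: "dy 0 (G r) w * ?y 0 w + dy (Suc 0) (G r) w * ?y (Suc 0) w = 2 * G r w" if "r < 2" "w \<in> U" for r w
    using Euler_homogeneous_2[OF n smooth hom] that by simp
  have euler_dy: "dy 0 (dy m (G r)) w * ?y 0 w + dy (Suc 0) (dy m (G r)) w * ?y (Suc 0) w = dy m (G r) w"
    if "m < 2" "r < 2" "w \<in> U" for m r w
    using Euler_homogeneous_2[OF n _ hdy, of m r w] smooth_on_pd[OF smooth idx(2)] that by simp
  \<comment> \<open>Euler's relation for G differentiated once more. A base coordinate gives the
    identity for the mixed derivatives, a fibre coordinate the one for the second fibre
    derivatives.\<close>
  have pd_euler: "pd a (dy 0 (G r)) w * ?y 0 w + dy 0 (G r) w * (if a = Inr 0 then 1 else 0)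
      + (pd a (dy (Suc 0) (G r)) w * ?y (Suc 0) w + dy (Suc 0) (G r) w * (if a = Inr (Suc 0) then 1 else 0)) = 2 * pd a (G r) w"
    if "r < 2" "w \<in> U" "a \<in> tidx 2" for r w a
  proof -
    have "pd a (\<lambda>w. dy 0 (G r) w * ?y 0 w + dy (Suc 0) (G r) w * ?y (Suc 0) w) w = pd a (\<lambda>w. 2 * G r w) w"
      using that by (intro pd_cong[OF U]) (auto simp: euler)
    then show ?thesis
      using that
      by (simp add: pd_add[OF U] pd_mult[OF U] pd_const pd_coord intros smooth idx one)
  qed
  have R_y: "riemann 2 G r 0 w * ?y 0 w + riemann 2 G r (Suc 0) w * ?y (Suc 0) w = 0"
    if r: "r < 2" and w: "w \<in> U" for r w
  proof -
    have "dx m (dy 0 (G r)) w * ?y 0 w + dx m (dy (Suc 0) (G r)) w * ?y (Suc 0) w = 2 * dx m (G r) w"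
      if "m < 2" for m
      using pd_euler[OF r w idx(1)[OF that]] by simp
    note x = this[OF one(2)] this[OF one(1)]
    have y: "dy 0 (dy 0 (G r)) w * ?y 0 w + dy 0 (dy (Suc 0) (G r)) w * ?y (Suc 0) w = dy 0 (G r) w"
      "dy (Suc 0) (dy 0 (G r)) w * ?y 0 w + dy (Suc 0) (dy (Suc 0) (G r)) w * ?y (Suc 0) w = dy (Suc 0) (G r) w"
      using pd_euler[OF r w idx(2)[OF one(2)]] pd_euler[OF r w idx(2)[OF one(1)]] by simp_all
    show ?thesis
      using x y euler[OF one(2) w] euler[OF one(1) w]
      unfolding riemann_def sum_lessThan_2 by algebra
  qed
  have smooth_R: "?S (riemann 2 G r m)" if "r < 2" "m < 2" for r m
    unfolding riemann_def[abs_def] using that by (intro intros smooth idx) auto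
  have smooth_A: "?S (weyl_A 2 G r m)" if "r < 2" "m < 2" for r m
    unfolding weyl_A_def[abs_def] using that by (intro intros smooth_R) auto
  have hom_R: "homogeneous_on 2 U 2 (riemann 2 G r m)" if "r < 2" "m < 2" for r m
  proof -
    have d2: "homogeneous_on 2 U 0 (dy p (dy q (G r)))" if "p < 2" "q < 2" "r < 2" for p q r
      using homogeneous_on_dy[of "dy q (G r)" 0 p] hdy[of q r] smooth_on_pd[OF smooth idx(2)] that n by simp
    have c: "homogeneous_on 2 U 1 (\<lambda>w. w (Inr p))" if "p < 2" for p
      using that by (auto simp: homogeneous_on_def)
    note mult = homogeneous_on_mult[unfolded n]
    have "homogeneous_on 2 U 2 (\<lambda>w. dx p (dy m (G r)) w * w (Inr p))" if "p < 2" for p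
      using mult[of 1 _ 1] homogeneous_on_dx[unfolded n, OF smooth_on_pd[OF smooth idx(2)] hdy] c that \<open>r < 2\<close> \<open>m < 2\<close>
      by (simp add: numeral_2_eq_2)
    moreover have "homogeneous_on 2 U 2 (\<lambda>w. G p w * dy p (dy m (G r)) w)" if "p < 2" for p
      using mult[of 2 _ 0] hom d2 that \<open>r < 2\<close> \<open>m < 2\<close> by simp
    moreover have "homogeneous_on 2 U 2 (\<lambda>w. dy p (G r) w * dy m (G p) w)" if "p < 2" for p
      using mult[of 1 _ 1] hdy that \<open>r < 2\<close> \<open>m < 2\<close> by (simp add: numeral_2_eq_2)
    ultimately show ?thesis
      unfolding riemann_def[abs_def]
      using that
      by (intro homogeneous_on_diff[unfolded n] homogeneous_on_add[unfolded n] homogeneous_on_sum[unfolded n]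
          homogeneous_on_cmult[unfolded n] homogeneous_on_dx[unfolded n] hom smooth) auto
  qed
  have hom_A: "homogeneous_on 2 U 2 (weyl_A 2 G r m)" if "r < 2" "m < 2" for r m
    using hom_R that by (auto simp: homogeneous_on_def weyl_A_def sum_lessThan_2 algebra_simps)
  \<comment> \<open>Removing the trace of a 2 by 2 matrix swaps its diagonal entries up to sign:
    \<open>A^0_0 = - R^1_1\<close> and \<open>A^1_1 = - R^0_0\<close>. Thus \<open>R_y\<close> says
    that each column of A is parallel to y.\<close>
  have A: "?y (Suc 0) w * weyl_A 2 G 0 m w = ?y 0 w * weyl_A 2 G (Suc 0) m w" if "m < 2" "w \<in> U" for m w
    using R_y[OF _ that(2), of 0] R_y[OF _ that(2), of "Suc 0"] that(1)
    by (auto simp: weyl_A_def sum_lessThan_2 less_2_cases_iff algebra_simps)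
  have pd_A: "pd a (weyl_A 2 G 0 m) w * ?y (Suc 0) w + weyl_A 2 G 0 m w * (if a = Inr (Suc 0) then 1 else 0)
      = pd a (weyl_A 2 G (Suc 0) m) w * ?y 0 w + weyl_A 2 G (Suc 0) m w * (if a = Inr 0 then 1 else 0)"
    if "m < 2" "w \<in> U" "a \<in> tidx 2" for m w a
  proof -
    have "pd a (\<lambda>w. ?y (Suc 0) w * weyl_A 2 G 0 m w) w = pd a (\<lambda>w. ?y 0 w * weyl_A 2 G (Suc 0) m w) w"
      using that by (intro pd_cong[OF U]) (auto simp: A)
    then show ?thesis
      using that
      by (simp add: pd_mult[OF U] pd_coord intros smooth_A idx one algebra_simps)
  qed
  have euler_A: "dy 0 (weyl_A 2 G r m) w * ?y 0 w + dy (Suc 0) (weyl_A 2 G r m) w * ?y (Suc 0) w = 2 * weyl_A 2 G r m w"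
    if "r < 2" "m < 2" "w \<in> U" for r m w
    using Euler_homogeneous_2[OF n smooth_A hom_A] that by simp
  \<comment> \<open>Heuristically \<open>A^i_k = a_k y^i\<close> with \<open>a_k\<close> homogeneous
    of degree one, so the divergence of column k is \<open>a_k + 2 a_k = 3 a_k\<close>. The
    derivatives of the parallelism relation and Euler's relation give this without dividing by a
    coordinate. The 3 is n + 1.\<close>
  have "3 * weyl_A 2 G i k z = (dy 0 (weyl_A 2 G 0 k) z + dy (Suc 0) (weyl_A 2 G (Suc 0) k) z) * ?y i z"
    using i pd_A[OF k z idx(2)[OF one(2)]] pd_A[OF k z idx(2)[OF one(1)]]
      euler_A[OF one(2) k z] euler_A[OF one(1) k z]
    by (auto simp: less_2_cases_iff algebra_simps)
  then show ?thesis
    by (simp add: weyl_curvature_def sum_lessThan_2)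
qed

subsection \<open>The Douglas tensor of a spray vanishing along a hypersurface\<close>

context slit_domain
begin

lemma idx: "m < n \<Longrightarrow> Inl m \<in> tidx n" "m < n \<Longrightarrow> Inr m \<in> tidx n" "Inl 0 \<in> tidx n"
  using n_pos by auto

definition vanishing :: "(tcoords \<Rightarrow> real) \<Rightarrow> bool" where
  "vanishing f \<longleftrightarrow> (\<forall>z\<in>U. z (Inl 0) = 0 \<longrightarrow> f z = 0)"

text \<open>Every coordinate line other than that of \<open>Inl 0\<close> stays inside the
  hypersurface; only the \<open>Inl 0\<close> derivative is transverse.\<close>

lemma vanishing_pd: "vanishing f \<Longrightarrow> a \<in> tidx n \<Longrightarrow> a \<noteq> Inl 0 \<Longrightarrow> vanishing (pd a f)"
  unfolding vanishing_def
  by (intro ballI impI, rule pd_eq_zero_if_locally_zero[OF openin_U]) auto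

lemma pd_square_mult:
  assumes "\<And>z. z \<in> U \<Longrightarrow> f z = (z (Inl 0))\<^sup>2 * g z" "smooth_on (tidx n) U g" "a \<in> tidx n" "z \<in> U"
  shows "pd a f z = (z (Inl 0))\<^sup>2 * pd a g z + (if a = Inl 0 then 2 * z (Inl 0) * g z else 0)"
proof -
  have "pd a f z = pd a (\<lambda>z. z (Inl 0) * (z (Inl 0) * g z)) z"
    by (rule pd_cong[OF openin_U assms(4,3)]) (simp add: assms(1) power2_eq_square)
  also have "\<dots> = (z (Inl 0))\<^sup>2 * pd a g z + (if a = Inl 0 then 2 * z (Inl 0) * g z else 0)"
    using assms(2-4) idx(3)
    by (simp add: pd_mult[OF openin_U] smooth_intros pd_coord power2_eq_square algebra_simps)
  finally show ?thesis .
qed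

text \<open>On the hypersurface each connection term carries a factor T or a fibre derivative of T,
  both zero. Only the transverse derivative survives, whatever G is.\<close>

lemma berwald_deriv_0_at_zero:
  assumes van: "\<And>j i k l. j < n \<Longrightarrow> i < n \<Longrightarrow> k < n \<Longrightarrow> l < n \<Longrightarrow> vanishing (T j i k l)"
    and "j < n" "i < n" "k < n" "l < n" and z: "z \<in> U" "z (Inl 0) = 0"
  shows "berwald_deriv_0 n G T j i k l z = dx 0 (T j i k l) z * z (Inr 0)"
proof -
  have T0: "T j i k l z = 0" if "j < n" "i < n" "k < n" "l < n" for j i k l
    using van[OF that] z by (simp add: vanishing_def)
  have T1: "pd a (T j i k l) z = 0" if "a \<in> tidx n" "a \<noteq> Inl 0" for a
    using vanishing_pd[OF van[OF assms(2-5)] that] z by (simp add: vanishing_def)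
  have "berwald_h_deriv n G T m j i k l z * z (Inr m) = (if m = 0 then dx 0 (T j i k l) z * z (Inr 0) else 0)"
    if "m < n" for m
    using assms(2-5) T1[OF idx(1)[OF that]] T1[OF idx(2)] T0
    by (simp add: berwald_h_deriv_def)
  then show ?thesis
    using n_pos by (simp add: berwald_deriv_0_def)
qed

lemma pd_mult_vanishing:
  assumes "smooth_on (tidx n) U f" "smooth_on (tidx n) U g" "vanishing f" "vanishing g"
    and "z \<in> U" "z (Inl 0) = 0" "a \<in> tidx n"
  shows "pd a (\<lambda>z. f z * g z) z = 0"
  using assms by (simp add: pd_mult[OF openin_U] vanishing_def)

text \<open>Now each connection term is a product of two vanishing functions, one from G and one
  from T, so even its first derivatives vanish on the hypersurface.\<close>

lemma dx_0_berwald_deriv_0_at_zero: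
  assumes G: "\<And>i. i < n \<Longrightarrow> smooth_on (tidx n) U (G i)"
    and vanG: "\<And>i. i < n \<Longrightarrow> vanishing (G i)"
    and T: "\<And>j i k l. j < n \<Longrightarrow> i < n \<Longrightarrow> k < n \<Longrightarrow> l < n \<Longrightarrow> smooth_on (tidx n) U (T j i k l)"
    and van: "\<And>j i k l. j < n \<Longrightarrow> i < n \<Longrightarrow> k < n \<Longrightarrow> l < n \<Longrightarrow> vanishing (T j i k l)"
    and ijkl: "j < n" "i < n" "k < n" "l < n" and z: "z \<in> U" "z (Inl 0) = 0"
  shows "dx 0 (berwald_deriv_0 n G T j i k l) z = (\<Sum>m<n. dx 0 (dx m (T j i k l)) z * z (Inr m))"
proof -
  note pds = pd_mult[OF openin_U] pd_add[OF openin_U] pd_diff[OF openin_U] pd_sum[OF openin_U]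
  have zero: "dx 0 (\<lambda>z. \<Sum>r<n. f r z * g r z) z = 0"
    if "\<And>r. r < n \<Longrightarrow> smooth_on (tidx n) U (f r)" "\<And>r. r < n \<Longrightarrow> smooth_on (tidx n) U (g r)"
      "\<And>r. r < n \<Longrightarrow> vanishing (f r)" "\<And>r. r < n \<Longrightarrow> vanishing (g r)" for f g :: "nat \<Rightarrow> tcoords \<Rightarrow> real"
    using that z idx(3) by (subst pds) (auto intro!: smooth_intros pd_mult_vanishing sum.neutral)
  have dG: "smooth_on (tidx n) U (dy m (G r))" "vanishing (dy m (G r))"
    "smooth_on (tidx n) U (dy q (dy m (G r)))" "vanishing (dy q (dy m (G r)))"
    if "m < n" "q < n" "r < n" for m q r
    using that by (auto intro!: smooth_intros vanishing_pd G vanG idx)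
  have dT: "smooth_on (tidx n) U (dy m (T j i k l))" "vanishing (dy m (T j i k l))"
    "smooth_on (tidx n) U (dx m (T j i k l))" if "m < n" for m
    using that ijkl by (auto intro!: smooth_intros vanishing_pd T van idx)
  have s: "smooth_on (tidx n) U (\<lambda>z. \<Sum>r<n. f r z * g r z)"
    if "\<And>r. r < n \<Longrightarrow> smooth_on (tidx n) U (f r)" "\<And>r. r < n \<Longrightarrow> smooth_on (tidx n) U (g r)"
    for f g :: "nat \<Rightarrow> tcoords \<Rightarrow> real"
    using that by (auto intro!: smooth_intros)
  have h: "dx 0 (berwald_h_deriv n G T m j i k l) z = dx 0 (dx m (T j i k l)) z"
    "smooth_on (tidx n) U (berwald_h_deriv n G T m j i k l)" if "m < n" for m
    unfolding berwald_h_deriv_def[abs_def]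
    using that ijkl z(1) idx(3)
    by (simp_all add: pd_add[OF openin_U] pd_diff[OF openin_U] smooth_on_add[OF openin_U]
        smooth_on_diff[OF openin_U] zero s dG dT T van)
  have "dx 0 (berwald_deriv_0 n G T j i k l) z
      = (\<Sum>m<n. dx 0 (\<lambda>z. berwald_h_deriv n G T m j i k l z * z (Inr m)) z)"
    unfolding berwald_deriv_0_def[abs_def]
    by (rule pd_sum[OF openin_U _ idx(3) z(1)]) (auto intro!: smooth_intros h idx)
  also have "\<dots> = (\<Sum>m<n. dx 0 (dx m (T j i k l)) z * z (Inr m))"
  proof (rule sum.cong[OF refl])
    fix m
    assume "m \<in> {..<n}"
    then have m: "m < n" by simp
    show "dx 0 (\<lambda>z. berwald_h_deriv n G T m j i k l z * z (Inr m)) z = dx 0 (dx m (T j i k l)) z * z (Inr m)"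
      by (subst pd_mult[OF openin_U h(2)[OF m] smooth_on_coord[OF idx(2)[OF m]] idx(3) z(1)])
        (simp add: h(1)[OF m] pd_coord)
  qed
  finally show ?thesis .
qed

end

text \<open>The left side of \<open>projective_part\<close> is the expression whose third fibre
  derivatives form the Douglas tensor. So \<open>\<phi>\<close> is a potential for that tensor after
  the factor \<open>(z (Inl 0))\<^sup>2\<close> has been split off.\<close>

locale quadratic_zero = slit_domain +
  fixes G :: "nat \<Rightarrow> tcoords \<Rightarrow> real" and \<phi> :: "nat \<Rightarrow> tcoords \<Rightarrow> real"
  assumes smooth_G: "i < n \<Longrightarrow> smooth_on (tidx n) U (G i)"
    and vanishing_G: "i < n \<Longrightarrow> vanishing (G i)"
    and smooth_\<phi>: "i < n \<Longrightarrow> smooth_on (tidx n) U (\<phi> i)"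
    and projective_part: "i < n \<Longrightarrow> z \<in> U \<Longrightarrow>
      G i z - 1 / (real n + 1) * (\<Sum>m<n. dy m (G m) z) * z (Inr i) = (z (Inl 0))\<^sup>2 * \<phi> i z"
begin

lemma douglas_eq:
  assumes "j < n" "i < n" "k < n" "l < n" "z \<in> U"
  shows "douglas n G j i k l z = (z (Inl 0))\<^sup>2 * dy j (dy k (dy l (\<phi> i))) z"
proof -
  have *: "dy m f z = (z (Inl 0))\<^sup>2 * dy m g z"
    if "\<And>z. z \<in> U \<Longrightarrow> f z = (z (Inl 0))\<^sup>2 * g z" "smooth_on (tidx n) U g" "m < n" "z \<in> U" for f g m z
    using pd_square_mult[OF that(1,2) idx(2)[OF that(3)] that(4)] by simp
  show ?thesis
    unfolding douglas_def using assms
    by (intro * smooth_intros idx smooth_\<phi> projective_part)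
qed

lemma smooth_on_douglas:
  assumes "j < n" "i < n" "k < n" "l < n"
  shows "smooth_on (tidx n) U (douglas n G j i k l)"
  unfolding douglas_def using assms by (intro smooth_intros idx smooth_G) auto

lemma vanishing_douglas:
  "j < n \<Longrightarrow> i < n \<Longrightarrow> k < n \<Longrightarrow> l < n \<Longrightarrow> vanishing (douglas n G j i k l)"
  by (simp add: vanishing_def douglas_eq)

lemma dx_douglas:
  assumes "j < n" "i < n" "k < n" "l < n" "m < n" "z \<in> U"
  shows "dx m (douglas n G j i k l) z = (z (Inl 0))\<^sup>2 * dx m (dy j (dy k (dy l (\<phi> i)))) z
    + (if m = 0 then 2 * z (Inl 0) * dy j (dy k (dy l (\<phi> i))) z else 0)"
proof -
  have "smooth_on (tidx n) U (dy j (dy k (dy l (\<phi> i))))"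
    using assms by (intro smooth_intros idx smooth_\<phi>)
  then show ?thesis
    using pd_square_mult[where f = "douglas n G j i k l", OF douglas_eq[OF assms(1-4)] _ idx(1)[OF assms(5)] assms(6)]
    by simp
qed

lemma dx_dx_douglas:
  assumes "j < n" "i < n" "k < n" "l < n" "m < n" "z \<in> U" "z (Inl 0) = 0"
  shows "dx 0 (dx m (douglas n G j i k l)) z = (if m = 0 then 2 * dy j (dy k (dy l (\<phi> i))) z else 0)"
proof -
  let ?E = "dy j (dy k (dy l (\<phi> i)))"
  have E: "smooth_on (tidx n) U ?E"
    using assms by (intro smooth_intros idx smooth_\<phi>)
  \<comment> \<open>With one factor \<open>z (Inl 0)\<close> pulled out, the product rule at a zero
    of this factor leaves just the value of the cofactor.\<close>
  have "dx 0 (dx m (douglas n G j i k l)) z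
    = dx 0 (\<lambda>z. z (Inl 0) * (z (Inl 0) * dx m ?E z + (if m = 0 then 2 else 0) * ?E z)) z"
    using assms by (intro pd_cong[OF openin_U _ idx(3)]) (auto simp: dx_douglas power2_eq_square algebra_simps)
  also have "\<dots> = (if m = 0 then 2 * ?E z else 0)"
    using assms(5-) idx(1)[OF assms(5)] idx(3) E
    by (simp add: pd_mult[OF openin_U] smooth_intros pd_coord)
  finally show ?thesis .
qed

text \<open>One derivative of a multiple of \<open>(z (Inl 0))\<^sup>2\<close> still retains a
  factor \<open>z (Inl 0)\<close>.\<close>

lemma vanishing_douglas_tilde:
  assumes "j < n" "i < n" "k < n" "l < n"
  shows "vanishing (douglas_tilde n G j i k l)"
  using berwald_deriv_0_at_zero[where G = G, OF vanishing_douglas assms] dx_douglas[OF assms n_pos]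
  by (simp add: vanishing_def douglas_tilde_def)

text \<open>Two covariant derivatives along y use up both factors \<open>z (Inl 0)\<close>, each
  contributing one \<open>z (Inr 0)\<close>; the 2 is the second derivative of the square.\<close>

lemma berwald_deriv_0_douglas_tilde:
  assumes "j < n" "i < n" "k < n" "l < n" "z \<in> U" "z (Inl 0) = 0"
  shows "berwald_deriv_0 n G (douglas_tilde n G) j i k l z
    = 2 * (z (Inr 0))\<^sup>2 * dy j (dy k (dy l (\<phi> i))) z"
proof -
  have "berwald_deriv_0 n G (douglas_tilde n G) j i k l z = dx 0 (douglas_tilde n G j i k l) z * z (Inr 0)"
    by (rule berwald_deriv_0_at_zero[OF vanishing_douglas_tilde assms])
  also have "dx 0 (douglas_tilde n G j i k l) z = (\<Sum>m<n. dx 0 (dx m (douglas n G j i k l)) z * z (Inr m))"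
    unfolding douglas_tilde_def
    by (rule dx_0_berwald_deriv_0_at_zero[OF smooth_G vanishing_G smooth_on_douglas vanishing_douglas assms])
  also have "\<dots> = 2 * dy j (dy k (dy l (\<phi> i))) z * z (Inr 0)"
    using assms n_pos by (simp add: dx_dx_douglas if_distrib[of "\<lambda>x. x * _"] cong: if_cong)
  finally show ?thesis
    by (simp add: power2_eq_square)
qed

end

subsection \<open>A Randers metric on a strip\<close>

text \<open>The space is a retract of the power over the whole countable index type, which has a
  countable basis as a Euclidean product. The section is the identity, since extensional functions
  are already total.\<close>

lemma second_countable_powertop_real:
  "second_countable (powertop_real (I :: 'k::countable set))"
proof (rule second_countable_retraction_map_image)
  have "continuous_map (powertop_real UNIV) (powertop_real I) (\<lambda>x. restrict x I)"
    unfolding continuous_map_componentwise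
    by (auto intro!: continuous_map_product_projection)
  moreover have "continuous_map (powertop_real I) (powertop_real UNIV) (\<lambda>x. x)"
    unfolding continuous_map_componentwise_UNIV
  proof
    fix k
    show "continuous_map (powertop_real I) euclideanreal (\<lambda>x. x k)"
    proof (cases "k \<in> I")
      case False
      \<comment> \<open>Outside \<open>I\<close> all extensional functions share the value
        \<open>undefined\<close>, so this coordinate is constant and thus continuous.\<close>
      then have "undefined = x k" if "x \<in> topspace (powertop_real I)" for x :: "'k \<Rightarrow> real"
        using that PiE_arb[of x I "\<lambda>_. UNIV" k] by simp
      moreover have "continuous_map (powertop_real I) euclideanreal (\<lambda>_. undefined)"
        by simp
      ultimately show ?thesis
        using continuous_map_eq by metis
    qed (rule continuous_map_product_projection)
  qed
  ultimately have "retraction_maps (powertop_real UNIV) (powertop_real I) (\<lambda>x. restrict x I) (\<lambda>x. x)"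
    by (auto simp: retraction_maps_def PiE_restrict)
  then show "retraction_map (powertop_real UNIV) (powertop_real I) (\<lambda>x. restrict x I)"
    by (auto simp: retraction_map_def)
  obtain B :: "('k \<Rightarrow> real) set set" where "countable B" "topological_basis B"
    using ex_countable_basis by auto
  then show "second_countable (powertop_real (UNIV :: 'k set))"
    unfolding second_countable_def euclidean_product_topology
    by (metis open_openin topological_basis_def topological_basisE)
qed

section \<open>The strip as a manifold with a single chart\<close>

definition strip :: "(nat \<Rightarrow> real) set" where
  "strip = {x \<in> PiE {..<2} (\<lambda>_. UNIV). \<bar>x 0\<bar> < 1}"

definition strip_chart :: "(nat \<Rightarrow> real) chart" where
  "strip_chart = (strip, \<lambda>x. x)"

abbreviation strip_slit :: "tcoords set" where
  "strip_slit \<equiv> slit_dom 2 strip_chart"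

text \<open>The Euclidean norm plus the one-form \<open>(x^0)^3 dx^1\<close>. Its coefficient is
  below 1 in absolute value on the strip, which is the positivity condition for Randers metrics, and
  its exterior derivative vanishes to second order at \<open>x^0 = 0\<close>.\<close>

definition randers :: "(nat \<Rightarrow> real) \<Rightarrow> (nat \<Rightarrow> real) tvec \<Rightarrow> real" where
  "randers p v = sqrt ((v strip_chart 0)\<^sup>2 + (v strip_chart 1)\<^sup>2) + (p 0) ^ 3 * v strip_chart 1"

lemma openin_strip: "openin (powertop_real {..<2}) strip"
proof -
  have "openin (powertop_real {..<2::nat}) {x \<in> topspace (powertop_real {..<2}). x 0 \<in> {-1<..<1}}"
    by (rule openin_continuous_map_preimage[OF continuous_map_product_projection]) auto
  moreover have "strip = {x \<in> topspace (powertop_real {..<2}). x 0 \<in> {-1<..<1}}"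
    by (simp add: strip_def abs_less_iff set_eq_iff conj_commute)
  ultimately show ?thesis by simp
qed

lemma fst_strip_chart [simp]: "fst strip_chart = strip"
  and snd_strip_chart [simp]: "snd strip_chart = (\<lambda>x. x)"
  by (simp_all add: strip_chart_def)

lemma chart_inv_strip [simp]: "x \<in> strip \<Longrightarrow> chart_inv strip_chart x = x"
  using inv_into_f_f[of "\<lambda>x. x" strip x] by (simp add: chart_inv_def)

lemma chart_change_strip [simp]: "x \<in> strip \<Longrightarrow> chart_change strip_chart strip_chart x = x"
  by (simp add: chart_change_def)

lemma smooth_manifold_strip:
  "smooth_manifold 2 (subtopology (powertop_real {..<2}) strip) {strip_chart}"
proof -
  have "strip \<subseteq> topspace (powertop_real {..<2})"
    by (rule openin_subset[OF openin_strip])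
  moreover have "Hausdorff_space (subtopology (powertop_real {..<2::nat}) strip)"
    by (intro Hausdorff_space_subtopology) (simp add: Hausdorff_space_product_topology)
  moreover have "smooth_on {..<2} strip (\<lambda>x. chart_change strip_chart strip_chart x i)" if "i < 2" for i
    using smooth_on_cong[OF openin_strip, of "\<lambda>x. chart_change strip_chart strip_chart x i" "\<lambda>x. x i"] that
    by (simp add: smooth_on_coord)
  moreover have "homeomorphic_map (subtopology (powertop_real {..<2}) strip)
      (subtopology (powertop_real {..<2}) strip) (\<lambda>x. x)"
    by (simp add: homeomorphic_map_id[unfolded id_def])
  moreover have "openin (subtopology (powertop_real {..<2}) strip) strip"
    using openin_strip by (simp add: openin_open_subtopology)
  ultimately show ?thesis
    using openin_strip
    by (auto simp: smooth_manifold_def second_countable_subtopology second_countable_powertop_real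
        subtopology_subtopology Int_absorb1)
qed

lemma charts_at_strip: "p \<in> strip \<Longrightarrow> charts_at {strip_chart} p = {strip_chart}"
  by (auto simp: charts_at_def)

lemma jacobian_strip:
  assumes "x \<in> strip" "j < 2"
  shows "jacobian strip_chart strip_chart x i j = (if i = j then 1 else 0)"
proof -
  have "pd j (\<lambda>x'. chart_change strip_chart strip_chart x' i) x = pd j (\<lambda>x'. x' i) x"
    using assms by (intro pd_cong[OF openin_strip]) auto
  then show ?thesis by (simp add: jacobian_def pd_coord)
qed

lemma strip_slit_eq:
  "strip_slit = {z \<in> PiE (tidx 2) (\<lambda>_. UNIV). \<bar>z (Inl 0)\<bar> < 1 \<and> (z (Inr 0) \<noteq> 0 \<or> z (Inr (Suc 0)) \<noteq> 0)}"
  by (auto simp: slit_dom_def strip_def base_def less_2_cases_iff)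

interpretation strip: slit_domain 2 strip_chart strip_slit
  by unfold_locales (simp_all add: openin_strip)

section \<open>The metric in induced coordinates and its derivatives\<close>

definition nrm :: "tcoords \<Rightarrow> real" where
  "nrm z = sqrt ((z (Inr 0))\<^sup>2 + (z (Inr (Suc 0)))\<^sup>2)"

definition rep :: "tcoords \<Rightarrow> real" where
  "rep z = nrm z + z (Inl 0) ^ 3 * z (Inr (Suc 0))"

lemma local_rep_randers:
  assumes "z \<in> strip_slit"
  shows "local_rep 2 {strip_chart} randers strip_chart z = rep z"
proof -
  have b: "base 2 z \<in> strip" using assms by (simp add: slit_dom_def)
  have "tvec_of 2 {strip_chart} strip_chart (base 2 z) (\<lambda>i. z (Inr i)) strip_chart i = z (Inr i)"
    if "i < 2" for i
    using that b by (simp add: tvec_of_def charts_at_strip jacobian_strip if_distrib[of "\<lambda>x. x * _"] cong: if_cong)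
  then show ?thesis
    using b by (simp add: local_rep_def randers_def rep_def nrm_def Let_def base_def)
qed

lemma nrm_pos: "z \<in> strip_slit \<Longrightarrow> 0 < nrm z"
  by (auto simp: strip_slit_eq nrm_def sum_power2_gt_zero_iff)

lemma nrm_square: "nrm z * nrm z = (z (Inr 0))\<^sup>2 + (z (Inr (Suc 0)))\<^sup>2"
  by (simp add: nrm_def)

text \<open>The chain \<open>|c b| \<le> |b| \<le> sqrt (a\<^sup>2 + b\<^sup>2)\<close> gives the
  bound. For b nonzero its first inequality is strict; for b = 0 the root is |a|.\<close>

lemma add_sqrt_nonneg:
  fixes a b c :: real
  assumes "\<bar>c\<bar> < 1"
  shows "0 \<le> sqrt (a\<^sup>2 + b\<^sup>2) + c * b" and "a \<noteq> 0 \<or> b \<noteq> 0 \<Longrightarrow> 0 < sqrt (a\<^sup>2 + b\<^sup>2) + c * b"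
proof -
  have *: "\<bar>b\<bar> \<le> sqrt (a\<^sup>2 + b\<^sup>2)" by (rule real_le_rsqrt) simp
  have **: "\<bar>c * b\<bar> \<le> \<bar>b\<bar>" using assms by (simp add: abs_mult mult_left_le_one_le)
  show "0 \<le> sqrt (a\<^sup>2 + b\<^sup>2) + c * b" using * ** by linarith
  show "0 < sqrt (a\<^sup>2 + b\<^sup>2) + c * b" if "a \<noteq> 0 \<or> b \<noteq> 0"
  proof (cases "b = 0")
    case True
    then show ?thesis using that by simp
  next
    case False
    then have "\<bar>c * b\<bar> < \<bar>b\<bar>" using assms by (simp add: abs_mult)
    with * show ?thesis by linarith
  qed
qed

lemma abs_cube_less_1: "\<bar>x\<bar> < 1 \<Longrightarrow> \<bar>x ^ 3\<bar> < 1" for x :: real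
  by (simp add: power_abs power_less_one_iff)

lemma rep_pos: "z \<in> strip_slit \<Longrightarrow> 0 < rep z"
  using add_sqrt_nonneg(2)[OF abs_cube_less_1] by (auto simp: strip_slit_eq rep_def nrm_def)

text \<open>Polynomials in the coordinates, \<open>nrm\<close> and \<open>inrm\<close> are closed
  under differentiation, and the relation \<open>nrm * inrm = 1\<close> reduces later identities to
  ring computations.\<close>

definition inrm :: "tcoords \<Rightarrow> real" where
  "inrm z = 1 / nrm z"

lemma nrm_inrm: "z \<in> strip_slit \<Longrightarrow> nrm z * inrm z = 1"
  using nrm_pos[of z] by (simp add: inrm_def)

lemma coord_idx: "Inl 0 \<in> tidx 2" "Inl (Suc 0) \<in> tidx 2" "Inr 0 \<in> tidx 2" "Inr (Suc 0) \<in> tidx 2"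
  by auto

lemma smooth_nrm: "smooth_on (tidx 2) strip_slit nrm"
  unfolding nrm_def[abs_def] power2_eq_square
  by (intro smooth_on_sqrt[OF strip.openin_U] strip.smooth_intros coord_idx)
    (auto simp: strip_slit_eq sum_squares_gt_zero_iff)

lemma smooth_inrm: "smooth_on (tidx 2) strip_slit inrm"
  unfolding inrm_def[abs_def]
  by (intro smooth_on_divide[OF strip.openin_U] smooth_nrm smooth_on_const) (auto dest: nrm_pos)

lemma smooth_rep: "smooth_on (tidx 2) strip_slit rep"
  unfolding rep_def[abs_def]
  by (intro smooth_on_power[OF strip.openin_U] strip.smooth_intros coord_idx smooth_nrm)

lemma has_pd_nrm:
  assumes "z \<in> strip_slit" "a \<in> tidx 2"
  shows "((\<lambda>t. nrm (z(a := t))) has_real_derivative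
    (case a of Inl _ \<Rightarrow> 0 | Inr i \<Rightarrow> z (Inr i) * inrm z)) (at (z a))"
proof -
  consider i where "a = Inl i" | "a = Inr 0" | "a = Inr (Suc 0)"
    using assms(2) by (auto simp: less_2_cases_iff)
  moreover have pos: "0 < (z (Inr 0))\<^sup>2 + (z (Inr (Suc 0)))\<^sup>2"
    using assms(1) by (auto simp: strip_slit_eq sum_power2_gt_zero_iff)
  ultimately show ?thesis
  proof cases
    case 2
    have "((\<lambda>t. sqrt (t\<^sup>2 + (z (Inr (Suc 0)))\<^sup>2)) has_real_derivative z (Inr 0) * inrm z) (at (z (Inr 0)))"
      by (rule DERIV_cong[OF DERIV_sqrt_eq[where f = "(\<lambda>t. t\<^sup>2 + (z (Inr (Suc 0)))\<^sup>2)" and D = "2 * z (Inr 0)", OF _ refl pos]])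
        (auto intro!: derivative_eq_intros simp: nrm_def inrm_def inverse_eq_divide)
    then show ?thesis using 2 by (simp add: nrm_def)
  next
    case 3
    have "((\<lambda>t. sqrt ((z (Inr 0))\<^sup>2 + t\<^sup>2)) has_real_derivative z (Inr (Suc 0)) * inrm z) (at (z (Inr (Suc 0))))"
      by (rule DERIV_cong[OF DERIV_sqrt_eq[where f = "(\<lambda>t. (z (Inr 0))\<^sup>2 + t\<^sup>2)" and D = "2 * z (Inr (Suc 0))", OF _ refl pos]])
        (auto intro!: derivative_eq_intros simp: nrm_def inrm_def inverse_eq_divide)
    then show ?thesis using 3 by (simp add: nrm_def)
  qed (auto simp: nrm_def)
qed

lemma pd_nrm:
  "z \<in> strip_slit \<Longrightarrow> a \<in> tidx 2 \<Longrightarrow> pd a nrm z = (case a of Inl _ \<Rightarrow> 0 | Inr i \<Rightarrow> z (Inr i) * inrm z)"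
  unfolding pd_def by (rule DERIV_imp_deriv[OF has_pd_nrm])

lemma pd_inrm:
  assumes "z \<in> strip_slit" "a \<in> tidx 2"
  shows "pd a inrm z = (case a of Inl _ \<Rightarrow> 0 | Inr i \<Rightarrow> - (z (Inr i) * inrm z ^ 3))"
proof -
  have "((\<lambda>t. inverse (nrm (z(a := t)))) has_real_derivative
     - 1 * (case a of Inl _ \<Rightarrow> 0 | Inr i \<Rightarrow> z (Inr i) * inrm z) * (inverse (nrm z) * inverse (nrm z))) (at (z a))"
    by (rule DERIV_inverse_eq[OF has_pd_nrm[OF assms]])
      (use nrm_pos[OF assms(1)] in \<open>simp_all only: fun_upd_triv less_imp_neq[symmetric] not_False_eq_True\<close>)
  then have "deriv (\<lambda>t. inverse (nrm (z(a := t)))) (z a) =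
     - 1 * (case a of Inl _ \<Rightarrow> 0 | Inr i \<Rightarrow> z (Inr i) * inrm z) * (inverse (nrm z) * inverse (nrm z))"
    by (rule DERIV_imp_deriv)
  then show ?thesis
    by (simp add: pd_def inrm_def inverse_eq_divide power3_eq_cube split: sum.split)
qed

lemmas smooth_strip = smooth_on_uminus[OF strip.openin_U] smooth_on_divide_const[OF strip.openin_U]
  strip.smooth_intros smooth_on_power[OF strip.openin_U] coord_idx
  smooth_nrm smooth_inrm smooth_rep

lemmas pd_strip = pd_uminus[OF strip.openin_U] pd_divide_const[OF strip.openin_U]
  pd_add[OF strip.openin_U] pd_mult[OF strip.openin_U] pd_diff[OF strip.openin_U]
  pd_const pd_coord pd_nrm pd_inrm

lemma less_2E: "(i::nat) < 2 \<Longrightarrow> (i = 0 \<Longrightarrow> P) \<Longrightarrow> (i = Suc 0 \<Longrightarrow> P) \<Longrightarrow> P"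
  by (auto simp: less_2_cases_iff)

lemma pd_rep:
  assumes "z \<in> strip_slit" "a \<in> tidx 2"
  shows "pd a rep z = (case a of
      Inl i \<Rightarrow> if i = 0 then 3 * (z (Inl 0))\<^sup>2 * z (Inr (Suc 0)) else 0
    | Inr i \<Rightarrow> z (Inr i) * inrm z + (if i = 0 then 0 else z (Inl 0) ^ 3))"
proof -
  have "pd a rep z = pd a (\<lambda>z. nrm z + z (Inl 0) * (z (Inl 0) * (z (Inl 0) * z (Inr (Suc 0))))) z"
    by (rule pd_cong[OF strip.openin_U assms]) (simp add: rep_def power3_eq_cube)
  also have "\<dots> = (case a of
      Inl i \<Rightarrow> if i = 0 then 3 * (z (Inl 0))\<^sup>2 * z (Inr (Suc 0)) else 0
    | Inr i \<Rightarrow> z (Inr i) * inrm z + (if i = 0 then 0 else z (Inl 0) ^ 3))"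
    using assms
    by (auto simp: pd_strip smooth_strip power2_eq_square power3_eq_cube less_2_cases_iff split: sum.split)
  finally show ?thesis .
qed

definition rep_dy :: "nat \<Rightarrow> tcoords \<Rightarrow> real" where
  "rep_dy l z = z (Inr l) * inrm z + (if l = 0 then 0 else z (Inl 0) ^ 3)"

text \<open>The quarter turn of y. The Euclidean metric identifies vectors with covectors, so it
  serves both in the spray and in the fundamental tensor.\<close>

definition rot :: "nat \<Rightarrow> tcoords \<Rightarrow> real" where
  "rot i z = (if i = 0 then - z (Inr (Suc 0)) else z (Inr 0))"

lemma smooth_rep_dy: "l < 2 \<Longrightarrow> smooth_on (tidx 2) strip_slit (rep_dy l)"
  unfolding rep_dy_def[abs_def] by (erule less_2E) (simp_all add: smooth_strip)

lemma dy_rep: "z \<in> strip_slit \<Longrightarrow> l < 2 \<Longrightarrow> dy l rep z = rep_dy l z"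
  by (simp add: pd_rep rep_dy_def InrI)

lemma dy_rep_square:
  assumes "z \<in> strip_slit" "l < 2"
  shows "dy l (\<lambda>w. (rep w)\<^sup>2) z = 2 * (rep z * rep_dy l z)"
  unfolding power2_eq_square using assms
  by (simp add: pd_strip smooth_strip pd_rep rep_dy_def InrI)

lemma dx_rep_square:
  assumes "z \<in> strip_slit" "l < 2"
  shows "dx l (\<lambda>w. (rep w)\<^sup>2) z = (if l = 0 then 6 * (z (Inl 0))\<^sup>2 * z (Inr (Suc 0)) * rep z else 0)"
  unfolding power2_eq_square using assms
  by (simp add: pd_strip smooth_strip pd_rep InlI power2_eq_square)

text \<open>The left side is the Hessian of the Euclidean norm. In the plane it has rank one,
  because the projection orthogonal to y is the projection onto its quarter turn.\<close>

lemma rot_inrm: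
  assumes "z \<in> strip_slit" "l < 2" "i < 2"
  shows "(if i = l then inrm z else 0) - z (Inr i) * z (Inr l) * inrm z ^ 3 = rot i z * rot l z * inrm z ^ 3"
proof -
  have "inrm z = (z (Inr 0) * z (Inr 0) + z (Inr (Suc 0)) * z (Inr (Suc 0))) * inrm z ^ 3"
    using nrm_inrm[OF assms(1)] nrm_square[of z] by algebra
  then show ?thesis
    using assms(2,3) by (auto simp: rot_def less_2_cases_iff algebra_simps)
qed

lemma pd_rep_dy:
  assumes "z \<in> strip_slit" "l < 2" "a \<in> tidx 2"
  shows "pd a (rep_dy l) z = (case a of
      Inl i \<Rightarrow> if i = 0 \<and> l \<noteq> 0 then 3 * (z (Inl 0))\<^sup>2 else 0
    | Inr i \<Rightarrow> rot i z * rot l z * inrm z ^ 3)"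
proof -
  have "pd a (rep_dy l) z
    = pd a (\<lambda>z. z (Inr l) * inrm z + (if l = 0 then 0 else 1) * (z (Inl 0) * (z (Inl 0) * z (Inl 0)))) z"
    by (rule pd_cong[OF strip.openin_U assms(1,3)]) (simp add: rep_dy_def power3_eq_cube)
  also have "\<dots> = (case a of
      Inl i \<Rightarrow> if i = 0 \<and> l \<noteq> 0 then 3 * (z (Inl 0))\<^sup>2 else 0
    | Inr i \<Rightarrow> (if i = l then inrm z else 0) - z (Inr i) * z (Inr l) * inrm z ^ 3)"
    using assms
    by (auto simp: pd_strip smooth_strip power2_eq_square power3_eq_cube less_2_cases_iff split: sum.split)
  finally have *: "pd a (rep_dy l) z = (case a of
      Inl i \<Rightarrow> if i = 0 \<and> l \<noteq> 0 then 3 * (z (Inl 0))\<^sup>2 else 0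
    | Inr i \<Rightarrow> (if i = l then inrm z else 0) - z (Inr i) * z (Inr l) * inrm z ^ 3)" .
  show ?thesis
  proof (cases a)
    case (Inr i)
    with assms(3) have "i < 2" by auto
    from trans[OF *[unfolded Inr sum.case] rot_inrm[OF assms(1,2) this]]
    show ?thesis unfolding Inr sum.case .
  qed (use * in simp)
qed

section \<open>The fundamental tensor and its positivity\<close>

lemma fund_tensor_cong:
  assumes "\<And>z. z \<in> strip_slit \<Longrightarrow> L z = M z" "z \<in> strip_slit" "i < 2" "j < 2"
  shows "fund_tensor L i j z = fund_tensor M i j z"
  unfolding fund_tensor_def
  using assms by (intro arg_cong[where f = "(*) (1/2)"] pd_cong[OF strip.openin_U]) auto

text \<open>Half the Hessian of \<open>F\<^sup>2\<close> is \<open>F_i F_j + F F_ij\<close>; the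
  one-form is linear in y, so \<open>F_ij\<close> is the Hessian of the Euclidean norm.\<close>

lemma fund_tensor_rep:
  assumes z: "z \<in> strip_slit" and "i < 2" "j < 2"
  shows "fund_tensor rep i j z = rep_dy i z * rep_dy j z + rep z * inrm z ^ 3 * rot i z * rot j z"
proof -
  have ij: "Inr i \<in> tidx 2" "Inr j \<in> tidx 2" using assms by auto
  have "dy i (dy j (\<lambda>w. (rep w)\<^sup>2)) z = dy i (\<lambda>w. 2 * (rep w * rep_dy j w)) z"
    using assms by (intro pd_cong[OF strip.openin_U z ij(1)] dy_rep_square)
  also have "\<dots> = 2 * (rep_dy i z * rep_dy j z + rep z * (rot i z * rot j z * inrm z ^ 3))"
    using assms ij by (simp add: pd_strip smooth_strip smooth_rep_dy dy_rep pd_rep_dy)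
  finally show ?thesis by (simp add: fund_tensor_def)
qed

lemma rep_dy_y: "z \<in> strip_slit \<Longrightarrow> rep_dy 0 z * z (Inr 0) + rep_dy (Suc 0) z * z (Inr (Suc 0)) = rep z"
  using nrm_inrm[of z] nrm_square[of z] by (simp add: rep_dy_def rep_def) algebra

text \<open>The gradient of the Euclidean norm is radial and hence orthogonal to \<open>rot\<close>;
  only the one-form contributes.\<close>

lemma rep_dy_rot: "rep_dy 0 z * rot 0 z + rep_dy (Suc 0) z * rot (Suc 0) z = z (Inl 0) ^ 3 * z (Inr 0)"
  by (simp add: rep_dy_def rot_def algebra_simps)

lemma fund_tensor_rep_pos:
  assumes z: "z \<in> strip_slit" and u: "\<exists>i<2. u i \<noteq> 0"
  shows "0 < (\<Sum>i<2. \<Sum>j<2. fund_tensor rep i j z * u i * u j)"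
proof -
  let ?p = "rep_dy 0 z * u 0 + rep_dy (Suc 0) z * u (Suc 0)" and ?q = "rot 0 z * u 0 + rot (Suc 0) z * u (Suc 0)"
  have eq: "(\<Sum>i<2. \<Sum>j<2. fund_tensor rep i j z * u i * u j) = ?p\<^sup>2 + rep z * inrm z ^ 3 * ?q\<^sup>2"
    using z by (simp add: sum_lessThan_2 fund_tensor_rep power2_eq_square algebra_simps)
  have pos: "0 < rep z * inrm z ^ 3"
    using rep_pos[OF z] nrm_pos[OF z] by (simp add: inrm_def)
  \<comment> \<open>If \<open>?q\<close> is zero then u is parallel to y, and Euler's relation turns
    \<open>?p = 0\<close> into \<open>rep z * u i = 0\<close>, against positivity of the
    metric.\<close>
  have "?p \<noteq> 0 \<or> ?q \<noteq> 0"
  proof (rule ccontr)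
    assume "\<not> (?p \<noteq> 0 \<or> ?q \<noteq> 0)"
    then have "rep z * u 0 = 0" "rep z * u (Suc 0) = 0"
      using rep_dy_y[OF z, symmetric] by (simp_all add: rot_def) algebra+
    then show False
      using rep_pos[OF z] u by (auto simp: less_2_cases_iff)
  qed
  then show ?thesis
    unfolding eq using pos
    by (metis add_nonneg_pos add_pos_nonneg mult_nonneg_nonneg mult_pos_pos less_imp_le zero_le_power2 zero_less_power2)
qed

section \<open>Computation of the spray coefficients\<close>

lemma spray_eqI:
  assumes inv: "\<exists>h. \<forall>a<n. \<forall>b<n. (\<Sum>r<n. h a r * fund_tensor L r b z) = (if a = b then 1 else (0::real))"
    and eq: "\<And>l. l < n \<Longrightarrow> 4 * (\<Sum>j<n. fund_tensor L l j z * G j)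
      = (\<Sum>k<n. dx k (dy l (\<lambda>w. (L w)\<^sup>2)) z * z (Inr k)) - dx l (\<lambda>w. (L w)\<^sup>2) z"
    and i: "i < n"
  shows "spray n L i z = G i"
proof -
  \<comment> \<open>The inverse is a choice among left inverses. Any left inverse recovers a
    solution of the lowered linear system, so the existence of one is all that is needed.\<close>
  define h where "h = (SOME h. \<forall>a<n. \<forall>b<n. (\<Sum>r<n. h a r * fund_tensor L r b z) = (if a = b then 1 else (0::real)))"
  have h: "(\<Sum>r<n. h a r * fund_tensor L r b z) = (if a = b then 1 else 0)" if "a < n" "b < n" for a b
    using someI_ex[OF inv] that unfolding h_def by blast
  have "spray n L i z = 1/4 * (\<Sum>l<n. h i l * (4 * (\<Sum>j<n. fund_tensor L l j z * G j)))"
    by (simp add: spray_def fund_tensor_inv_def h_def eq)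
  also have "\<dots> = (\<Sum>l<n. \<Sum>j<n. h i l * fund_tensor L l j z * G j)"
    by (simp add: sum_distrib_left mult_ac)
  also have "\<dots> = (\<Sum>j<n. (\<Sum>l<n. h i l * fund_tensor L l j z) * G j)"
    by (subst sum.swap) (simp add: sum_distrib_right)
  also have "\<dots> = G i"
    using i by (simp add: h if_distrib[of "\<lambda>x. x * _"] cong: if_cong)
  finally show ?thesis .
qed

text \<open>The spray coefficients of a Randers metric \<open>\<alpha> + \<beta>\<close> are
  \<open>G\<^sup>i\<^sub>\<alpha> + P y\<^sup>i + \<alpha> s\<^sup>i\<^sub>0\<close> with \<open>P = (r\<^sub>0\<^sub>0 - 2 \<alpha> s\<^sub>0) / (2 F)\<close>; here \<open>\<alpha>\<close> is
  Euclidean, and \<open>r\<close> and \<open>s\<close> are the symmetric and antisymmetric parts of \<open>\<nabla>\<beta>\<close>.\<close>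

definition geodesic_P :: "tcoords \<Rightarrow> real" where
  "geodesic_P z = 3 * (z (Inl 0))\<^sup>2 * z (Inr 0) * (z (Inr (Suc 0)) - nrm z * z (Inl 0) ^ 3) / (2 * rep z)"

definition geodesic_G :: "nat \<Rightarrow> tcoords \<Rightarrow> real" where
  "geodesic_G i z = geodesic_P z * z (Inr i) + 3/2 * (z (Inl 0))\<^sup>2 * nrm z * rot i z"

text \<open>Bridges \<open>local_rep\<close> and \<open>rep\<close>, which are compared on the slit
  domain only. The chosen inverses agree because the predicates they are chosen from
  coincide.\<close>

lemma spray_cong:
  assumes "\<And>z. z \<in> strip_slit \<Longrightarrow> L z = M z" "z \<in> strip_slit"
  shows "spray 2 L i z = spray 2 M i z"
proof -
  have sq: "pd a (\<lambda>w. (L w)\<^sup>2) w = pd a (\<lambda>w. (M w)\<^sup>2) w" if "a \<in> tidx 2" "w \<in> strip_slit" for a w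
    using that assms(1) by (intro pd_cong[OF strip.openin_U]) auto
  have "dx k (dy l (\<lambda>w. (L w)\<^sup>2)) z = dx k (dy l (\<lambda>w. (M w)\<^sup>2)) z" if "k < 2" "l < 2" for k l
    using that assms(2) by (intro pd_cong[OF strip.openin_U, of z "Inl k"] sq) auto
  moreover have "(\<forall>a<2. \<forall>b<2. (\<Sum>r<2. h a r * fund_tensor L r b z) = (if a = b then 1 else 0))
     \<longleftrightarrow> (\<forall>a<2. \<forall>b<2. (\<Sum>r<2. h a r * fund_tensor M r b z) = (if a = b then 1 else (0::real)))" for h
    using assms by (simp add: fund_tensor_cong[of L M])
  then have "fund_tensor_inv 2 L i l z = fund_tensor_inv 2 M i l z" for i l
    by (simp add: fund_tensor_inv_def)
  ultimately show ?thesis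
    using sq[of "Inl _" z] assms(2) by (simp add: spray_def InlI)
qed

lemma spray_rep:
  assumes z: "z \<in> strip_slit" and i: "i < 2"
  shows "spray 2 rep i z = geodesic_G i z"
proof (rule spray_eqI[OF _ _ i])
  let ?g = "\<lambda>i j. fund_tensor rep i j z"
  define D where "D = ?g 0 0 * ?g (Suc 0) (Suc 0) - ?g 0 (Suc 0) * ?g (Suc 0) 0"
  \<comment> \<open>A sum \<open>v v^T + s w w^T\<close> has determinant
    \<open>s (v_0 w_1 - v_1 w_0)^2\<close>. With w the quarter turn of y, the bracket is the pairing
    of v with y, which Euler's relation evaluates to \<open>rep z\<close>.\<close>
  have "D = rep z * inrm z ^ 3 * (rep_dy 0 z * z (Inr 0) + rep_dy (Suc 0) z * z (Inr (Suc 0)))\<^sup>2"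
    using z by (simp add: D_def fund_tensor_rep rot_def power2_eq_square algebra_simps)
  also have "\<dots> = rep z * inrm z ^ 3 * (rep z)\<^sup>2"
    by (simp only: rep_dy_y[OF z])
  finally have "D \<noteq> 0"
    using rep_pos[OF z] nrm_pos[OF z] by (simp add: inrm_def)
  then show "\<exists>h. \<forall>a<2. \<forall>b<2. (\<Sum>r<2. h a r * ?g r b) = (if a = b then 1 else (0::real))"
    \<comment> \<open>The adjugate divided by the determinant.\<close>
    by (intro exI[of _ "\<lambda>a r. (if a = r then ?g (1 - a) (1 - a) else - ?g a r) / D"])
      (auto simp: sum_lessThan_2 less_2_cases_iff divide_simps, simp_all add: D_def algebra_simps)
next
  fix l :: nat
  assume l: "l < 2"
  have P: "2 * (geodesic_P z * rep z) = 3 * (z (Inl 0))\<^sup>2 * z (Inr 0) * (z (Inr (Suc 0)) - nrm z * z (Inl 0) ^ 3)"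
    using rep_pos[OF z] by (simp add: geodesic_P_def)
  \<comment> \<open>The fundamental tensor is built from \<open>rep_dy\<close> and
    \<open>rot\<close>, so the contractions of G with these two covectors determine the lowered G.
    The term with \<open>nrm z\<close> in \<open>geodesic_P\<close> cancels the contribution of
    \<open>rep_dy_rot\<close>; in \<open>G2\<close> the multiple of y drops out.\<close>
  have G1: "rep_dy 0 z * geodesic_G 0 z + rep_dy (Suc 0) z * geodesic_G (Suc 0) z
      = 3/2 * (z (Inl 0))\<^sup>2 * z (Inr 0) * z (Inr (Suc 0))"
    using P rep_dy_y[OF z] rep_dy_rot[of z] unfolding geodesic_G_def by (simp add: field_simps) algebra
  have G2: "rot 0 z * geodesic_G 0 z + rot (Suc 0) z * geodesic_G (Suc 0) z
      = 3/2 * (z (Inl 0))\<^sup>2 * nrm z ^ 3"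
    using nrm_square[of z] unfolding geodesic_G_def rot_def by (simp add: field_simps) algebra
  have "4 * (\<Sum>j<2. fund_tensor rep l j z * geodesic_G j z)
     = 6 * (z (Inl 0))\<^sup>2 * z (Inr 0) * z (Inr (Suc 0)) * rep_dy l z + 6 * (z (Inl 0))\<^sup>2 * rep z * rot l z"
    using G1 G2 nrm_inrm[OF z] l z
    by (simp add: fund_tensor_rep sum_lessThan_2) algebra
  moreover have "dx k (dy l (\<lambda>w. (rep w)\<^sup>2)) z =
     (if k = 0 then 2 * (3 * (z (Inl 0))\<^sup>2 * z (Inr (Suc 0)) * rep_dy l z + rep z * (if l = 0 then 0 else 3 * (z (Inl 0))\<^sup>2))
      else 0)" if "k < 2" for k
  proof -
    have k: "Inl k \<in> tidx 2" using that by auto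
    have "dx k (dy l (\<lambda>w. (rep w)\<^sup>2)) z = dx k (\<lambda>w. 2 * (rep w * rep_dy l w)) z"
      using l by (intro pd_cong[OF strip.openin_U z k] dy_rep_square)
    then show ?thesis
      using z k l by (simp add: pd_strip smooth_strip smooth_rep_dy pd_rep pd_rep_dy)
  qed
  ultimately show "4 * (\<Sum>j<2. fund_tensor rep l j z * geodesic_G j z)
      = (\<Sum>k<2. dx k (dy l (\<lambda>w. (rep w)\<^sup>2)) z * z (Inr k)) - dx l (\<lambda>w. (rep w)\<^sup>2) z"
    using l z by (auto simp: sum_lessThan_2 dx_rep_square rot_def less_2_cases_iff algebra_simps)
qed

section \<open>Smoothness and homogeneity of the spray, and the potential of its Douglas
  tensor\<close>

lemma smooth_geodesic_P: "smooth_on (tidx 2) strip_slit geodesic_P"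
  unfolding geodesic_P_def[abs_def]
  by (intro smooth_on_divide[OF strip.openin_U] smooth_strip) (auto dest: rep_pos)

lemma smooth_rot: "i < 2 \<Longrightarrow> smooth_on (tidx 2) strip_slit (rot i)"
  unfolding rot_def[abs_def]
  by (erule less_2E) (simp_all add: smooth_strip)

lemma smooth_geodesic_G: "i < 2 \<Longrightarrow> smooth_on (tidx 2) strip_slit (geodesic_G i)"
  unfolding geodesic_G_def[abs_def]
  by (intro smooth_strip smooth_geodesic_P smooth_rot) auto

lemma nrm_fibre_scale: "0 < a \<Longrightarrow> nrm (fibre_scale 2 a z) = a * nrm z"
  by (simp add: nrm_def power_mult_distrib real_sqrt_mult flip: distrib_left)

lemma rep_fibre_scale: "0 < a \<Longrightarrow> rep (fibre_scale 2 a z) = a * rep z"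
  by (simp add: rep_def nrm_fibre_scale algebra_simps)

lemma geodesic_P_fibre_scale: "0 < a \<Longrightarrow> geodesic_P (fibre_scale 2 a z) = a * geodesic_P z"
  by (simp add: geodesic_P_def nrm_fibre_scale rep_fibre_scale algebra_simps diff_divide_distrib)

lemma homogeneous_geodesic_G: "homogeneous_on 2 strip_slit 2 (geodesic_G i)" if "i < 2"
  using that by (simp add: homogeneous_on_def geodesic_G_def geodesic_P_fibre_scale nrm_fibre_scale rot_def
      power2_eq_square algebra_simps)

definition potential :: "nat \<Rightarrow> tcoords \<Rightarrow> real" where
  "potential i z = 3/2 * nrm z * rot i z"

lemma smooth_potential: "i < 2 \<Longrightarrow> smooth_on (tidx 2) strip_slit (potential i)"
  unfolding potential_def[abs_def] by (intro smooth_strip smooth_rot)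

text \<open>By Euler's relation the radial part P y has fibre divergence P + 2 P, while
  \<open>nrm\<close> times \<open>rot\<close> is divergence free. Since 3 = n + 1, the Douglas
  correction removes exactly the radial part and leaves \<open>(z (Inl 0))\<^sup>2\<close> times
  \<open>potential\<close>.\<close>

lemma divergence_geodesic_G:
  assumes z: "z \<in> strip_slit"
  shows "(\<Sum>m<2. dy m (geodesic_G m) z) = 3 * geodesic_P z"
proof -
  have "dy 0 geodesic_P z * z (Inr 0) + dy (Suc 0) geodesic_P z * z (Inr (Suc 0)) = geodesic_P z"
    using strip.Euler_homogeneous_2[OF refl smooth_geodesic_P _ z, of 1]
    by (simp add: homogeneous_on_def geodesic_P_fibre_scale)
  moreover have "dy 0 (geodesic_G 0) z = dy 0 (\<lambda>z. geodesic_P z * z (Inr 0)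
      - 3/2 * (z (Inl 0) * z (Inl 0)) * nrm z * z (Inr (Suc 0))) z"
    using z by (intro pd_cong[OF strip.openin_U]) (auto simp: geodesic_G_def rot_def power2_eq_square)
  moreover have "dy (Suc 0) (geodesic_G (Suc 0)) z = dy (Suc 0) (\<lambda>z. geodesic_P z * z (Inr (Suc 0))
      + 3/2 * (z (Inl 0) * z (Inl 0)) * nrm z * z (Inr 0)) z"
    using z by (intro pd_cong[OF strip.openin_U]) (auto simp: geodesic_G_def rot_def power2_eq_square)
  ultimately show ?thesis
    using z by (simp add: sum_lessThan_2 pd_strip smooth_strip smooth_geodesic_P)
qed

text \<open>For \<open>y^0 = 1\<close> the function is \<open>- 3/2 t sqrt (1 + t\<^sup>2)\<close>
  with \<open>t = y^1\<close>. Its cubic Taylor coefficient at 0 is - 3/4, whence the third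
  derivative - 9/2.\<close>

lemma dy_dy_dy_potential:
  assumes z: "z \<in> strip_slit" and y: "z (Inr 0) = 1" "z (Inr (Suc 0)) = 0"
  shows "dy (Suc 0) (dy (Suc 0) (dy (Suc 0) (potential 0))) z = - 9/2"
proof -
  let ?y = "\<lambda>z. z (Inr (Suc 0)) :: real"
  have 1: "dy (Suc 0) (potential 0) w = - 3/2 * (nrm w + inrm w * (?y w * ?y w))" if "w \<in> strip_slit" for w
  proof -
    have "dy (Suc 0) (potential 0) w = dy (Suc 0) (\<lambda>z. - 3/2 * (nrm z * ?y z)) w"
      using that by (intro pd_cong[OF strip.openin_U]) (auto simp: potential_def rot_def)
    then show ?thesis using that by (simp add: pd_strip smooth_strip)
  qed
  have 2: "dy (Suc 0) (dy (Suc 0) (potential 0)) w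
      = - 3/2 * (3 * (?y w * inrm w) - inrm w * (inrm w * inrm w) * (?y w * (?y w * ?y w)))"
    if w: "w \<in> strip_slit" for w
  proof -
    have "dy (Suc 0) (dy (Suc 0) (potential 0)) w = dy (Suc 0) (\<lambda>w. - 3/2 * (nrm w + inrm w * (?y w * ?y w))) w"
      using that by (intro pd_cong[OF strip.openin_U] 1) auto
    then show ?thesis using that
      by (simp add: pd_strip smooth_strip power3_eq_cube)
  qed
  have "dy (Suc 0) (dy (Suc 0) (dy (Suc 0) (potential 0))) z = dy (Suc 0) (\<lambda>w.
     - 3/2 * (3 * (?y w * inrm w) - inrm w * (inrm w * inrm w) * (?y w * (?y w * ?y w)))) z"
    using z by (intro pd_cong[OF strip.openin_U] 2) auto
  moreover have "inrm z = 1" using y by (simp add: inrm_def nrm_def)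
  ultimately show ?thesis
    using z y by (simp add: pd_strip smooth_strip)
qed

section \<open>The Finsler and Weyl properties, and failure of the generalized D-tilde
  condition\<close>

lemma finsler_metric_randers: "finsler_metric 2 {strip_chart} randers"
  unfolding finsler_metric_def
proof (intro conjI ballI allI impI)
  fix p v
  assume "p \<in> (\<Union>c\<in>{strip_chart}. fst c)" and v: "v \<in> tangent_space 2 {strip_chart} p"
  then have p: "p \<in> strip" by simp
  then have "\<bar>(p 0) ^ 3\<bar> < 1"
    by (intro abs_cube_less_1) (simp add: strip_def)
  then show "0 \<le> randers p v"
    unfolding randers_def by (rule add_sqrt_nonneg)
  show "randers p (tvec_scale 2 {strip_chart} p a v) = a * randers p v" if "0 < a" for a
  proof -
    have "sqrt ((a * b)\<^sup>2 + (a * c)\<^sup>2) = a * sqrt (b\<^sup>2 + c\<^sup>2)" for b c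
      using that by (simp add: power_mult_distrib real_sqrt_mult flip: distrib_left)
    then show ?thesis
      using p by (simp add: randers_def tvec_scale_def charts_at_strip distrib_left)
  qed
next
  fix c :: "(nat \<Rightarrow> real) chart"
  assume "c \<in> {strip_chart}"
  then show "smooth_on (tidx 2) (slit_dom 2 c) (local_rep 2 {strip_chart} randers c)"
    using smooth_on_cong[OF strip.openin_U local_rep_randers] smooth_rep by simp
next
  fix c :: "(nat \<Rightarrow> real) chart" and z :: tcoords and u :: "nat \<Rightarrow> real"
  assume "c \<in> {strip_chart}" "z \<in> slit_dom 2 c" "\<exists>i<2. u i \<noteq> 0"
  then show "0 < (\<Sum>i<2. \<Sum>j<2. fund_tensor (local_rep 2 {strip_chart} randers c) i j z * u i * u j)"
    using fund_tensor_rep_pos[of z u] by (simp add: fund_tensor_cong[OF local_rep_randers])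
qed

definition strip_spray :: "nat \<Rightarrow> tcoords \<Rightarrow> real" where
  "strip_spray = spray 2 (local_rep 2 {strip_chart} randers strip_chart)"

lemma strip_spray_eq: "z \<in> strip_slit \<Longrightarrow> i < 2 \<Longrightarrow> strip_spray i z = geodesic_G i z"
  by (simp add: strip_spray_def spray_cong[OF local_rep_randers] spray_rep)

lemma smooth_strip_spray: "i < 2 \<Longrightarrow> smooth_on (tidx 2) strip_slit (strip_spray i)"
  using smooth_on_cong[OF strip.openin_U, of "strip_spray i" "geodesic_G i"]
  by (simp add: strip_spray_eq smooth_geodesic_G)

lemma weyl_metric_randers: "weyl_metric 2 {strip_chart} randers"
proof -
  have hom: "homogeneous_on 2 strip_slit 2 (strip_spray i)" if "i < 2" for i
    using homogeneous_geodesic_G that strip.fibre_scale_in_U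
    by (simp add: homogeneous_on_def strip_spray_eq)
  have "weyl_curvature 2 strip_spray i k z = 0" if "z \<in> strip_slit" "i < 2" "k < 2" for z i k
    by (rule strip.weyl_curvature_surface_eq_0[OF refl smooth_strip_spray hom that])
  then show ?thesis
    by (simp add: weyl_metric_def finsler_metric_randers strip_spray_def)
qed

interpretation strip: quadratic_zero 2 strip_chart strip_slit strip_spray potential
proof
  fix i :: nat and z :: tcoords
  assume i: "i < 2"
  show "smooth_on (tidx 2) strip_slit (strip_spray i)" "smooth_on (tidx 2) strip_slit (potential i)"
    using i by (simp_all add: smooth_strip_spray smooth_potential)
  show "strip.vanishing (strip_spray i)"
    using i by (simp add: strip.vanishing_def strip_spray_eq geodesic_G_def geodesic_P_def)
  assume z: "z \<in> strip_slit"
  have "(\<Sum>m<2. dy m (strip_spray m) z) = (\<Sum>m<2. dy m (geodesic_G m) z)"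
    using z by (intro sum.cong pd_cong[OF strip.openin_U]) (auto simp: strip_spray_eq)
  then show "strip_spray i z - 1 / (real 2 + 1) * (\<Sum>m<2. dy m (strip_spray m) z) * z (Inr i)
      = (z (Inl 0))\<^sup>2 * potential i z"
    using z i by (simp add: divergence_geodesic_G strip_spray_eq geodesic_G_def potential_def)
qed

lemma not_generalized_D_tilde_metric_randers: "\<not> generalized_D_tilde_metric 2 {strip_chart} randers"
proof
  assume "generalized_D_tilde_metric 2 {strip_chart} randers"
  then obtain \<mu> where \<mu>: "\<forall>z\<in>strip_slit. \<forall>j<2. \<forall>i<2. \<forall>k<2. \<forall>l<2.
      berwald_deriv_0 2 strip_spray (douglas_tilde 2 strip_spray) j i k l z
      + (\<Sum>r<2. \<mu> strip_chart r z * douglas_tilde 2 strip_spray j r k l z) * z (Inr i) = 0"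
    unfolding generalized_D_tilde_metric_def Let_def strip_spray_def by blast
  \<comment> \<open>The point x = 0 with direction y = (1, 0), transverse to the
    hypersurface.\<close>
  define z :: tcoords where "z = (\<lambda>k\<in>tidx 2. if k = Inr 0 then 1 else 0)"
  have z: "z \<in> strip_slit" and z0: "z (Inl 0) = 0" "z (Inr 0) = 1" "z (Inr (Suc 0)) = 0"
    by (auto simp: z_def strip_slit_eq)
  \<comment> \<open>This removes the whole \<open>\<mu>\<close> term at z. What remains is twice the
    third derivative - 9/2 of the potential, as \<open>z (Inr 0) = 1\<close>.\<close>
  have "douglas_tilde 2 strip_spray (Suc 0) r (Suc 0) (Suc 0) z = 0" if "r < 2" for r
    using strip.vanishing_douglas_tilde[of "Suc 0" r "Suc 0" "Suc 0"] that z z0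
    by (simp add: strip.vanishing_def)
  moreover have "berwald_deriv_0 2 strip_spray (douglas_tilde 2 strip_spray) (Suc 0) 0 (Suc 0) (Suc 0) z = - 9"
    using z z0 by (simp add: strip.berwald_deriv_0_douglas_tilde dy_dy_dy_potential)
  ultimately show False
    using bspec[OF \<mu> z, THEN spec[of _ "Suc 0"], THEN mp, THEN spec[of _ 0], THEN mp,
        THEN spec[of _ "Suc 0"], THEN mp, THEN spec[of _ "Suc 0"]] z0 by simp
qed

theorem corollary4p10:
  shows "\<exists>(n::nat) (X :: (nat \<Rightarrow> real) topology) A F.
           2 \<le> n \<and> smooth_manifold n X A \<and> weyl_metric n A F \<and>
           \<not> generalized_D_tilde_metric n A F"
  using smooth_manifold_strip weyl_metric_randers not_generalized_D_tilde_metric_randers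
  by blast

end
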